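(* Let $m,n>0$ be real numbers and let $(\mathrm{Sol}^3_{m,n},g)$ be the three-dimensional solvable Lie group with its canonical left-invariant Riemannian metric $g=e^{-2mt}dx^2+e^{2nt}dy^2+dt^2$, with left-invariant orthonormal frame $e_1=e^{mt}\partial_x$, $e_2=e^{-nt}\partial_y$, $e_3=\partial_t$. A smooth vector field $\xi$ on $\mathrm{Sol}^3_{m,n}$ defines a Ricci soliton (i.e. there is a constant $\lambda\in\mathbb{R}$ with $\operatorname{Ric}+\frac12\mathcal{L}_\xi g=\lambda g$) if and only if there exist constants $c_1,c_2,c_3\in\mathbb{R}$ such that $$\xi=e^{-mt}\left[(mc_1-mn-n^2)x+c_2\right]e_1-e^{nt}\left[(nc_1+mn+m^2)y+c_3\right]e_2+c_1e_3 .$$ Moreover, in this case the Ricci soliton $(\mathrm{Sol}^3_{m,n},g,\xi,\lambda)$ is expanding, with $\lambda=-m^2-n^2$.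
   Context: For real $m,n>0$, $\mathrm{Sol}^3_{m,n}$ is the semidirect product $\mathbb{R}^2\rtimes_U\mathbb{R}$ with $U(t)=\mathrm{diag}(e^{mt},e^{-nt})$; its underlying manifold is $\mathbb{R}^3$ with global coordinates $(x,y,t)$. It carries the left-invariant Riemannian metric $g=e^{-2mt}dx^2+e^{2nt}dy^2+dt^2$. Curvature conventions: $R(X,Y)Z=[\nabla_X,\nabla_Y]Z-\nabla_{[X,Y]}Z$ and $\operatorname{Ric}(X,Y)=\sum_i g(R(X,e_i)e_i,Y)$ for a local orthonormal frame $\{e_i\}$, with $\nabla$ the Levi-Civita connection. A Ricci soliton $(M,g,\xi,\lambda)$ consists of a Riemannian manifold $(M,g)$, a smooth vector field $\xi$ and a real constant $\lambda$ with $\operatorname{Ric}+\frac12\mathcal{L}_\xi g=\lambda g$; it is expanding if $\lambda<0$. *)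

theory Defs
  imports "HOL-Analysis.Analysis"
begin

text \<open>
  Riemannian geometry on the manifold \<open>\<real>\<^sup>n\<close> with its global coordinates. A vector field
  is given by its components in the coordinate frame, i.e. \<open>X p $ i\<close> is the coefficient of
  \<open>\<partial>\<^sub>i\<close> at \<open>p\<close>. A \<open>(0,2)\<close>-tensor field such as a metric is given as the family of its
  values \<open>g p\<close> on pairs of tangent vectors at \<open>p\<close>.
\<close>

type_synonym 'n vector_field = "real ^ 'n \<Rightarrow> real ^ 'n"
type_synonym 'n tensor02 = "real ^ 'n \<Rightarrow> real ^ 'n \<Rightarrow> real ^ 'n \<Rightarrow> real"

primrec Ck_fun :: "nat \<Rightarrow> (real ^ 'n::finite \<Rightarrow> real) \<Rightarrow> bool" where
  "Ck_fun 0 f \<longleftrightarrow> continuous_on UNIV f"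
| "Ck_fun (Suc k) f \<longleftrightarrow> (\<forall>p. f differentiable (at p)) \<and>
     (\<forall>i. Ck_fun k (\<lambda>p. frechet_derivative f (at p) (axis i 1)))"

definition smooth_fun :: "(real ^ 'n::finite \<Rightarrow> real) \<Rightarrow> bool" where
  "smooth_fun f \<longleftrightarrow> (\<forall>k. Ck_fun k f)"

definition smooth_vf :: "'n::finite vector_field \<Rightarrow> bool" where
  "smooth_vf X \<longleftrightarrow> (\<forall>i. smooth_fun (\<lambda>p. X p $ i))"

text \<open>The derivative \<open>X(f)\<close> of a function \<open>f\<close> along a vector field \<open>X\<close>.\<close>

definition vf_apply :: "'n::finite vector_field \<Rightarrow> (real ^ 'n \<Rightarrow> real) \<Rightarrow> real ^ 'n \<Rightarrow> real" where
  "vf_apply X f = (\<lambda>p. frechet_derivative f (at p) (X p))"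

text \<open>In coordinates, \<open>[X,Y]\<^sup>i = X(Y\<^sup>i) - Y(X\<^sup>i)\<close>.\<close>

definition lie_bracket :: "'n::finite vector_field \<Rightarrow> 'n vector_field \<Rightarrow> 'n vector_field" where
  "lie_bracket X Y =
     (\<lambda>p. \<chi> i. vf_apply X (\<lambda>q. Y q $ i) p - vf_apply Y (\<lambda>q. X q $ i) p)"

definition riemannian_metric :: "'n::finite tensor02 \<Rightarrow> bool" where
  "riemannian_metric g \<longleftrightarrow>
     (\<forall>p. bilinear (g p)) \<and>
     (\<forall>p u v. g p u v = g p v u) \<and>
     (\<forall>p u. u \<noteq> 0 \<longrightarrow> g p u u > 0) \<and>
     (\<forall>i j. smooth_fun (\<lambda>p. g p (axis i 1) (axis j 1)))"

text \<open>
  A connection is an operator on smooth vector fields; its values on non-smooth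
  arguments are arbitrary and never used.
\<close>

definition affine_connection ::
  "('n::finite vector_field \<Rightarrow> 'n vector_field \<Rightarrow> 'n vector_field) \<Rightarrow> bool" where
  "affine_connection D \<longleftrightarrow>
     (\<forall>X Y. smooth_vf X \<longrightarrow> smooth_vf Y \<longrightarrow> smooth_vf (D X Y)) \<and>
     (\<forall>X X' Y. smooth_vf X \<longrightarrow> smooth_vf X' \<longrightarrow> smooth_vf Y \<longrightarrow>
        D (\<lambda>p. X p + X' p) Y = (\<lambda>p. D X Y p + D X' Y p)) \<and>
     (\<forall>f X Y. smooth_fun f \<longrightarrow> smooth_vf X \<longrightarrow> smooth_vf Y \<longrightarrow>
        D (\<lambda>p. f p *\<^sub>R X p) Y = (\<lambda>p. f p *\<^sub>R D X Y p)) \<and>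
     (\<forall>X Y Y'. smooth_vf X \<longrightarrow> smooth_vf Y \<longrightarrow> smooth_vf Y' \<longrightarrow>
        D X (\<lambda>p. Y p + Y' p) = (\<lambda>p. D X Y p + D X Y' p)) \<and>
     (\<forall>f X Y. smooth_fun f \<longrightarrow> smooth_vf X \<longrightarrow> smooth_vf Y \<longrightarrow>
        D X (\<lambda>p. f p *\<^sub>R Y p) = (\<lambda>p. vf_apply X f p *\<^sub>R Y p + f p *\<^sub>R D X Y p))"

definition levi_civita ::
  "'n::finite tensor02 \<Rightarrow> ('n vector_field \<Rightarrow> 'n vector_field \<Rightarrow> 'n vector_field) \<Rightarrow> bool" where
  "levi_civita g D \<longleftrightarrow>
     affine_connection D \<and>
     (\<forall>X Y. smooth_vf X \<longrightarrow> smooth_vf Y \<longrightarrow>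
        (\<forall>p. D X Y p - D Y X p = lie_bracket X Y p)) \<and>
     (\<forall>X Y Z. smooth_vf X \<longrightarrow> smooth_vf Y \<longrightarrow> smooth_vf Z \<longrightarrow>
        (\<forall>p. vf_apply X (\<lambda>q. g q (Y q) (Z q)) p = g p (D X Y p) (Z p) + g p (Y p) (D X Z p)))"

definition curvature ::
  "('n::finite vector_field \<Rightarrow> 'n vector_field \<Rightarrow> 'n vector_field) \<Rightarrow>
   'n vector_field \<Rightarrow> 'n vector_field \<Rightarrow> 'n vector_field \<Rightarrow> 'n vector_field" where
  "curvature D X Y Z = (\<lambda>p. D X (D Y Z) p - D Y (D X Z) p - D (lie_bracket X Y) Z p)"

definition orthonormal_frame :: "'n::finite tensor02 \<Rightarrow> ('n \<Rightarrow> 'n vector_field) \<Rightarrow> bool" where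
  "orthonormal_frame g E \<longleftrightarrow>
     (\<forall>i. smooth_vf (E i)) \<and>
     (\<forall>p i j. g p (E i p) (E j p) = (if i = j then 1 else 0))"

definition ricci ::
  "'n::finite tensor02 \<Rightarrow> ('n vector_field \<Rightarrow> 'n vector_field \<Rightarrow> 'n vector_field) \<Rightarrow>
   ('n \<Rightarrow> 'n vector_field) \<Rightarrow> 'n vector_field \<Rightarrow> 'n vector_field \<Rightarrow> real ^ 'n \<Rightarrow> real" where
  "ricci g D E X Y = (\<lambda>p. \<Sum>i\<in>UNIV. g p (curvature D X (E i) (E i) p) (Y p))"

text \<open>\<open>lie_derivative_metric g \<xi> X Y\<close> is the function \<open>(L\<^sub>\<xi> g)(X,Y)\<close>.\<close>

definition lie_derivative_metric ::
  "'n::finite tensor02 \<Rightarrow> 'n vector_field \<Rightarrow> 'n vector_field \<Rightarrow> 'n vector_field \<Rightarrow>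
   real ^ 'n \<Rightarrow> real" where
  "lie_derivative_metric g \<xi> X Y =
     (\<lambda>p. vf_apply \<xi> (\<lambda>q. g q (X q) (Y q)) p
        - g p (lie_bracket \<xi> X p) (Y p) - g p (X p) (lie_bracket \<xi> Y p))"

text \<open>
  The Levi-Civita connection \<open>D\<close> of \<open>g\<close> exists and is unique (on smooth fields), and
  \<open>ricci g D E\<close> does not depend on the orthonormal frame \<open>E\<close>; global frames exist on
  \<open>\<real>\<^sup>n\<close>. The existential quantifiers therefore only name these objects; they add no freedom.
\<close>

definition ricci_soliton :: "'n::finite tensor02 \<Rightarrow> 'n vector_field \<Rightarrow> real \<Rightarrow> bool" where
  "ricci_soliton g \<xi> c \<longleftrightarrow>
     riemannian_metric g \<and> smooth_vf \<xi> \<and>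
     (\<exists>D E. levi_civita g D \<and> orthonormal_frame g E \<and>
        (\<forall>X Y. smooth_vf X \<longrightarrow> smooth_vf Y \<longrightarrow>
           (\<forall>p. ricci g D E X Y p + 1/2 * lie_derivative_metric g \<xi> X Y p
                = c * g p (X p) (Y p))))"

definition expanding_ricci_soliton :: "'n::finite tensor02 \<Rightarrow> 'n vector_field \<Rightarrow> real \<Rightarrow> bool" where
  "expanding_ricci_soliton g \<xi> c \<longleftrightarrow> ricci_soliton g \<xi> c \<and> c < 0"

text \<open>
  The group \<open>Sol\<^sup>3\<^sub>m\<^sub>,\<^sub>n\<close> on \<open>\<real>\<^sup>3\<close>, with coordinates \<open>(x,y,t) = (p$1, p$2, p$3)\<close>: the product
  is \<open>(v,t)(w,s) = (v + U(t) w, t + s)\<close> with \<open>U(t) = diag(e\<^sup>m\<^sup>t, e\<^sup>-\<^sup>n\<^sup>t)\<close>.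
\<close>

definition sol_mult :: "real \<Rightarrow> real \<Rightarrow> real ^ 3 \<Rightarrow> real ^ 3 \<Rightarrow> real ^ 3" where
  "sol_mult m n p q =
     vector [p $ 1 + exp (m * p $ 3) * q $ 1, p $ 2 + exp (- n * p $ 3) * q $ 2, p $ 3 + q $ 3]"

definition sol_metric :: "real \<Rightarrow> real \<Rightarrow> 3 tensor02" where
  "sol_metric m n p u v =
     exp (- 2 * m * p $ 3) * u $ 1 * v $ 1 + exp (2 * n * p $ 3) * u $ 2 * v $ 2 + u $ 3 * v $ 3"

definition sol_e1 :: "real \<Rightarrow> real \<Rightarrow> 3 vector_field" where
  "sol_e1 m n p = exp (m * p $ 3) *\<^sub>R axis 1 1"

definition sol_e2 :: "real \<Rightarrow> real \<Rightarrow> 3 vector_field" where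
  "sol_e2 m n p = exp (- n * p $ 3) *\<^sub>R axis 2 1"

definition sol_e3 :: "real \<Rightarrow> real \<Rightarrow> 3 vector_field" where
  "sol_e3 m n p = axis 3 1"

lemma sol_mult_group:
  "sol_mult m n (sol_mult m n p q) r = sol_mult m n p (sol_mult m n q r)"
  "sol_mult m n 0 p = p"
  "\<exists>q. sol_mult m n q p = 0"
proof -
  show "sol_mult m n (sol_mult m n p q) r = sol_mult m n p (sol_mult m n q r)"
    by (simp add: sol_mult_def vec_eq_iff forall_3 vector_3 exp_add algebra_simps exp_diff exp_minus divide_inverse)
  show "sol_mult m n 0 p = p"
    by (simp add: sol_mult_def vec_eq_iff forall_3 vector_3)
  show "\<exists>q. sol_mult m n q p = 0"
    by (rule exI[of _ "vector [- exp (- m * p $ 3) * p $ 1, - exp (n * p $ 3) * p $ 2, - p $ 3]"])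
      (simp add: sol_mult_def vec_eq_iff forall_3 vector_3)
qed

lemma sol_mult_has_derivative:
  "(sol_mult m n a has_derivative
     (\<lambda>v. vector [exp (m * a $ 3) * v $ 1, exp (- n * a $ 3) * v $ 2, v $ 3])) (at p)"
proof (subst has_derivative_componentwise_within, intro ballI)
  fix b :: "real ^ 3" assume "b \<in> Basis"
  then obtain i where b: "b = axis i 1" by (auto simp: Basis_vec_def)
  have "\<forall>i. ((\<lambda>x. sol_mult m n a x $ i) has_derivative
     (\<lambda>v. (vector [exp (m * a $ 3) * v $ 1, exp (- n * a $ 3) * v $ 2, v $ 3] :: real ^ 3) $ i)) (at p)"
    unfolding forall_3 sol_mult_def vector_3
    by (auto intro!: derivative_eq_intros bounded_linear.has_derivative[OF bounded_linear_vec_nth])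
  then show "((\<lambda>x. sol_mult m n a x \<bullet> b) has_derivative
     (\<lambda>v. vector [exp (m * a $ 3) * v $ 1, exp (- n * a $ 3) * v $ 2, v $ 3] \<bullet> b)) (at p)"
    by (simp add: b inner_axis)
qed

lemma sol_frame_left_invariant:
  assumes "e \<in> {sol_e1 m n, sol_e2 m n, sol_e3 m n}"
  shows "frechet_derivative (sol_mult m n a) (at p) (e p) = e (sol_mult m n a p)"
  using assms
  by (auto simp: frechet_derivative_at[OF sol_mult_has_derivative, symmetric] vec_eq_iff forall_3
      sol_e1_def sol_e2_def sol_e3_def sol_mult_def vector_3 axis_def
      algebra_simps exp_add exp_diff exp_minus divide_inverse)

lemma sol_metric_left_invariant:
  "sol_metric m n (sol_mult m n a p)
     (frechet_derivative (sol_mult m n a) (at p) u) (frechet_derivative (sol_mult m n a) (at p) v)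
   = sol_metric m n p u v"
proof -
  let ?A = "exp (- 2 * m * (a $ 3 + p $ 3))" and ?B = "exp (2 * n * (a $ 3 + p $ 3))"
  have "?A * exp (m * a $ 3) * exp (m * a $ 3) = exp (- 2 * m * p $ 3)"
    "?B * exp (- n * a $ 3) * exp (- n * a $ 3) = exp (2 * n * p $ 3)"
    by (simp_all add: exp_add[symmetric] algebra_simps)
  moreover have "?A * (exp (m * a $ 3) * u $ 1) * (exp (m * a $ 3) * v $ 1)
        + ?B * (exp (- n * a $ 3) * u $ 2) * (exp (- n * a $ 3) * v $ 2)
      = (?A * exp (m * a $ 3) * exp (m * a $ 3)) * u $ 1 * v $ 1
        + (?B * exp (- n * a $ 3) * exp (- n * a $ 3)) * u $ 2 * v $ 2"
    by (simp only: ac_simps)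
  ultimately show ?thesis
    by (simp only: frechet_derivative_at[OF sol_mult_has_derivative, symmetric]
        sol_metric_def sol_mult_def vector_3)
qed

lemma sol_frame_orthonormal:
  "sol_metric m n p (sol_e1 m n p) (sol_e1 m n p) = 1"
  "sol_metric m n p (sol_e2 m n p) (sol_e2 m n p) = 1"
  "sol_metric m n p (sol_e3 m n p) (sol_e3 m n p) = 1"
  "sol_metric m n p (sol_e1 m n p) (sol_e2 m n p) = 0"
  "sol_metric m n p (sol_e1 m n p) (sol_e3 m n p) = 0"
  "sol_metric m n p (sol_e2 m n p) (sol_e3 m n p) = 0"
  by (simp_all add: sol_metric_def sol_e1_def sol_e2_def sol_e3_def axis_def exp_add[symmetric] mult_exp_exp)

end

theory Submission
  imports Defs
begin

text \<open>
  The Levi-Civita connection is written down in coordinates, and its uniqueness together with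
  the equality of mixed partial derivatives makes the curvature an explicit tensor. The Ricci
  tensor is then diagonal in the frame \<open>e\<^sub>1, e\<^sub>2, e\<^sub>3\<close>, with
  eigenvalues \<open>mn - m\<^sup>2, mn - n\<^sup>2, - m\<^sup>2 - n\<^sup>2\<close>, so for \<open>\<xi> = (u,v,w)\<close> the soliton
  equation is
  \<open>u\<^sub>x = m w + a\<close>, \<open>v\<^sub>y = - n w + b\<close>, \<open>w\<^sub>t = c\<close>,
  \<open>e\<^sup>-\<^sup>2\<^sup>m\<^sup>t u\<^sub>y + e\<^sup>2\<^sup>n\<^sup>t v\<^sub>x = 0\<close>,
  \<open>e\<^sup>-\<^sup>2\<^sup>m\<^sup>t u\<^sub>t + w\<^sub>x = 0\<close>, \<open>e\<^sup>2\<^sup>n\<^sup>t v\<^sub>t + w\<^sub>y = 0\<close>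
  with \<open>a = \<lambda> + m\<^sup>2 - mn\<close>, \<open>b = \<lambda> + n\<^sup>2 - mn\<close>, \<open>c = \<lambda> + m\<^sup>2 + n\<^sup>2\<close>.
  Integrating the last two equations in \<open>t\<close> and inserting the result into the first two forces \<open>c = 0\<close>
  and \<open>w\<close> to be affine in \<open>x\<close> and in \<open>y\<close>; linear independence of exponentials
  in the fourth equation then makes \<open>w\<close> constant.
\<close>

subsection \<open>Partial derivatives and smooth functions\<close>

definition pd :: "'n::finite \<Rightarrow> (real ^ 'n \<Rightarrow> real) \<Rightarrow> real ^ 'n \<Rightarrow> real" where
  "pd i f p = frechet_derivative f (at p) (axis i 1)"

lemma has_derivative_pd:
  fixes f :: "real ^ 'n::finite \<Rightarrow> real"
  assumes "(f has_derivative f') (at p)"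
  shows "pd i f p = f' (axis i 1)"
  unfolding pd_def using frechet_derivative_at[OF assms] by simp

text \<open>Along a coordinate line a partial derivative is an ordinary one. This opens the way to
  the one-variable mean value theorem and later to integrating the soliton system one variable at a
  time.\<close>

lemma pd_line:
  fixes f :: "real ^ 'n::finite \<Rightarrow> real"
  assumes "\<And>p. f differentiable (at p)"
  shows "((\<lambda>s. f (p + s *\<^sub>R axis i 1)) has_real_derivative pd i f (p + s *\<^sub>R axis i 1)) (at s)"
proof -
  let ?l = "\<lambda>s::real. p + s *\<^sub>R (axis i 1 :: real ^ 'n)"
  have d: "(f has_derivative frechet_derivative f (at (?l s))) (at (?l s))"
    using assms frechet_derivative_works by blast
  have l: "(?l has_derivative (\<lambda>h. h *\<^sub>R axis i 1)) (at s)"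
    by (auto intro!: derivative_eq_intros)
  have "((\<lambda>s. f (?l s)) has_derivative
      (\<lambda>h. frechet_derivative f (at (?l s)) (h *\<^sub>R axis i 1))) (at s)"
    by (rule has_derivative_compose[OF l d])
  moreover have "(\<lambda>h. frechet_derivative f (at (?l s)) (h *\<^sub>R axis i 1))
      = (*) (pd i f (?l s))"
    using linear_frechet_derivative[OF assms] by (auto simp: linear_cmul pd_def fun_eq_iff)
  ultimately show ?thesis
    by (simp add: has_field_derivative_def)
qed

section \<open>Symmetry of mixed partial derivatives\<close>

lemma second_difference_mvt:
  fixes f :: "real ^ 'n::finite \<Rightarrow> real"
  assumes f: "\<And>p. f differentiable (at p)" and df: "\<And>p. pd i f differentiable (at p)"
    and "h > 0"
  obtains s r where "0 < s" "s < h" "0 < r" "r < h"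
    "f (p + h *\<^sub>R axis i 1 + h *\<^sub>R axis j 1) - f (p + h *\<^sub>R axis i 1) - f (p + h *\<^sub>R axis j 1) + f p
      = h * h * pd j (pd i f) (p + s *\<^sub>R axis i 1 + r *\<^sub>R axis j 1)"
proof -
  let ?e = "axis i 1 :: real ^ 'n" and ?d = "axis j 1 :: real ^ 'n"
  \<comment> \<open>The second difference is the increment of \<open>?\<phi>\<close> over
    \<open>[0, h]\<close>. The mean value theorem is applied to it in direction \<open>i\<close>,
    and then to \<open>pd i f\<close> in direction \<open>j\<close>.\<close>
  let ?\<phi> = "\<lambda>s. f ((p + h *\<^sub>R ?d) + s *\<^sub>R ?e) - f (p + s *\<^sub>R ?e)"
  have "(?\<phi> has_real_derivative
      pd i f ((p + h *\<^sub>R ?d) + s *\<^sub>R ?e) - pd i f (p + s *\<^sub>R ?e)) (at s)" for s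
    by (intro DERIV_diff pd_line f)
  from MVT2[OF \<open>h > 0\<close> this] obtain s where s: "0 < s" "s < h"
    "?\<phi> h - ?\<phi> 0 = h * (pd i f ((p + h *\<^sub>R ?d) + s *\<^sub>R ?e) - pd i f (p + s *\<^sub>R ?e))"
    by auto
  have "((\<lambda>r. pd i f ((p + s *\<^sub>R ?e) + r *\<^sub>R ?d)) has_real_derivative
      pd j (pd i f) ((p + s *\<^sub>R ?e) + r *\<^sub>R ?d)) (at r)" for r
    by (intro pd_line df)
  from MVT2[OF \<open>h > 0\<close> this] obtain r where r: "0 < r" "r < h"
    "pd i f ((p + s *\<^sub>R ?e) + h *\<^sub>R ?d) - pd i f (p + s *\<^sub>R ?e)
      = h * pd j (pd i f) ((p + s *\<^sub>R ?e) + r *\<^sub>R ?d)"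
    by auto
  show ?thesis
    using s r by (intro that[of s r]) (simp_all add: algebra_simps)
qed

text \<open>The second difference is symmetric in \<open>i\<close> and \<open>j\<close>, so near
  \<open>p\<close> each mixed derivative takes a value that the other also takes. By continuity
  these values lie close to those at \<open>p\<close>; a gap of \<open>2 * e\<close> between the
  latter is contradictory.\<close>

lemma pd_commute:
  fixes f :: "real ^ 'n::finite \<Rightarrow> real"
  assumes f: "\<And>p. f differentiable (at p)"
    and fi: "\<And>p. pd i f differentiable (at p)" and fj: "\<And>p. pd j f differentiable (at p)"
    and ci: "continuous_on UNIV (pd j (pd i f))" and cj: "continuous_on UNIV (pd i (pd j f))"
  shows "pd i (pd j f) p = pd j (pd i f) p"
proof (rule ccontr)
  let ?u = "pd i (pd j f)" and ?v = "pd j (pd i f)"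
  assume "?u p \<noteq> ?v p"
  define e where "e = \<bar>?u p - ?v p\<bar> / 2"
  have "e > 0" using \<open>?u p \<noteq> ?v p\<close> by (simp add: e_def)
  obtain d1 where d1: "d1 > 0" "\<And>q. dist q p < d1 \<Longrightarrow> dist (?u q) (?u p) < e"
    using cj \<open>e > 0\<close> unfolding continuous_on_iff by (metis UNIV_I)
  obtain d2 where d2: "d2 > 0" "\<And>q. dist q p < d2 \<Longrightarrow> dist (?v q) (?v p) < e"
    using ci \<open>e > 0\<close> unfolding continuous_on_iff by (metis UNIV_I)
  \<comment> \<open>The intermediate points are reached by two steps shorter than \<open>h\<close>,
    hence lie within \<open>2 * h\<close> of \<open>p\<close>.\<close>
  define h where "h = min d1 d2 / 2"
  have h: "h > 0" "2 * h \<le> d1" "2 * h \<le> d2" using d1 d2 by (auto simp: h_def)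
  have near: "dist (p + s *\<^sub>R axis k 1 + r *\<^sub>R axis l 1) p < 2 * h"
    if "0 < s" "s < h" "0 < r" "r < h" for s r and k l :: 'n
  proof -
    have "norm (s *\<^sub>R (axis k 1 :: real ^ 'n) + r *\<^sub>R axis l 1) \<le> \<bar>s\<bar> + \<bar>r\<bar>"
      by (rule order_trans[OF norm_triangle_ineq]) (simp add: norm_axis_1)
    then show ?thesis using that by (simp add: dist_norm add.assoc)
  qed
  obtain s r where 1: "0 < s" "s < h" "0 < r" "r < h"
    "f (p + h *\<^sub>R axis i 1 + h *\<^sub>R axis j 1) - f (p + h *\<^sub>R axis i 1) - f (p + h *\<^sub>R axis j 1) + f p
      = h * h * ?v (p + s *\<^sub>R axis i 1 + r *\<^sub>R axis j 1)"
    using second_difference_mvt[OF f fi h(1)] .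
  obtain s' r' where 2: "0 < s'" "s' < h" "0 < r'" "r' < h"
    "f (p + h *\<^sub>R axis j 1 + h *\<^sub>R axis i 1) - f (p + h *\<^sub>R axis j 1) - f (p + h *\<^sub>R axis i 1) + f p
      = h * h * ?u (p + s' *\<^sub>R axis j 1 + r' *\<^sub>R axis i 1)"
    using second_difference_mvt[OF f fj h(1)] .
  have "h * h * ?v (p + s *\<^sub>R axis i 1 + r *\<^sub>R axis j 1)
      = h * h * ?u (p + s' *\<^sub>R axis j 1 + r' *\<^sub>R axis i 1)"
    using 1(5) 2(5) by (simp add: algebra_simps)
  then have "?v (p + s *\<^sub>R axis i 1 + r *\<^sub>R axis j 1) = ?u (p + s' *\<^sub>R axis j 1 + r' *\<^sub>R axis i 1)"
    using h(1) by simp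
  moreover have "dist (?v (p + s *\<^sub>R axis i 1 + r *\<^sub>R axis j 1)) (?v p) < e"
    using near[OF 1(1-4)] h(3) by (intro d2(2)) (rule less_le_trans)
  moreover have "dist (?u (p + s' *\<^sub>R axis j 1 + r' *\<^sub>R axis i 1)) (?u p) < e"
    using near[OF 2(1-4)] h(2) by (intro d1(2)) (rule less_le_trans)
  ultimately show False
    unfolding dist_real_def e_def by (auto simp: abs_if split: if_splits)
qed

section \<open>Closure properties of smooth functions\<close>

lemma Ck_fun_Suc_pd:
  "Ck_fun (Suc k) f \<longleftrightarrow> (\<forall>p. f differentiable (at p)) \<and> (\<forall>i. Ck_fun k (pd i f))"
  by (simp add: pd_def[abs_def])

declare Ck_fun.simps(2)[simp del]

lemma Ck_fun_SucD: "Ck_fun (Suc k) f \<Longrightarrow> Ck_fun k f"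
proof (induction k arbitrary: f)
  case 0
  then show ?case
    by (auto simp: Ck_fun_Suc_pd continuous_on_eq_continuous_at intro: differentiable_imp_continuous_within)
next
  case (Suc k)
  then show ?case
    by (simp add: Ck_fun_Suc_pd[of "Suc k"] Ck_fun_Suc_pd[of k])
qed

text \<open>Quantifying over all orders removes the index from the recursion;
  \<open>Ck_fun_SucD\<close> accounts for order zero.\<close>

lemma smooth_fun_pd_iff:
  "smooth_fun f \<longleftrightarrow> (\<forall>p. f differentiable (at p)) \<and> (\<forall>i. smooth_fun (pd i f))"
  unfolding smooth_fun_def
  by (metis Ck_fun_Suc_pd Ck_fun_SucD)

lemma smooth_fun_differentiable: "smooth_fun f \<Longrightarrow> f differentiable (at p)"
  using smooth_fun_pd_iff by blast

lemma smooth_fun_pd: "smooth_fun f \<Longrightarrow> smooth_fun (pd i f)"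
  using smooth_fun_pd_iff by blast

lemma smooth_fun_continuous: "smooth_fun f \<Longrightarrow> continuous_on UNIV f"
  unfolding smooth_fun_def by (metis Ck_fun.simps(1))

lemma smooth_fun_has_derivative:
  "smooth_fun f \<Longrightarrow> (f has_derivative frechet_derivative f (at p)) (at p)"
  using smooth_fun_differentiable frechet_derivative_works by blast

lemma smooth_pd_commute: "smooth_fun f \<Longrightarrow> pd i (pd j f) p = pd j (pd i f) p"
  by (intro pd_commute smooth_fun_differentiable smooth_fun_continuous smooth_fun_pd)

lemma pd_const [simp]: "pd i (\<lambda>p. c) p = 0"
  by (simp add: pd_def)

lemma pd_add:
  "f differentiable (at p) \<Longrightarrow> g differentiable (at p) \<Longrightarrow>
    pd i (\<lambda>q. f q + g q) p = pd i f p + pd i g p"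
  by (subst has_derivative_pd[OF has_derivative_add])
     (auto simp: frechet_derivative_works pd_def)

lemma pd_mult:
  "f differentiable (at p) \<Longrightarrow> g differentiable (at p) \<Longrightarrow>
    pd i (\<lambda>q. f q * g q) p = f p * pd i g p + pd i f p * g p"
  by (subst has_derivative_pd[OF has_derivative_mult])
     (auto simp: frechet_derivative_works pd_def)

lemma pd_coord: "pd i (\<lambda>q. q $ j) p = (if i = j then 1 else 0)"
  by (subst has_derivative_pd[OF bounded_linear.has_derivative[OF bounded_linear_vec_nth has_derivative_ident]])
     (simp add: axis_def)

lemma differentiable_coord [simp, intro]:
  "(\<lambda>q :: real ^ 'n::finite. q $ j) differentiable (at p)"
  by (intro bounded_linear_imp_differentiable bounded_linear_vec_nth)

lemma has_derivative_exp_comp: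
  fixes f :: "real ^ 'n::finite \<Rightarrow> real"
  assumes "f differentiable (at p)"
  shows "((\<lambda>q. exp (f q)) has_derivative (\<lambda>h. exp (f p) * frechet_derivative f (at p) h)) (at p)"
  using has_derivative_exp[OF assms[unfolded frechet_derivative_works]] by (simp add: mult.commute)

lemma pd_exp:
  fixes f :: "real ^ 'n::finite \<Rightarrow> real"
  assumes "f differentiable (at p)"
  shows "pd i (\<lambda>q. exp (f q)) p = exp (f p) * pd i f p"
  by (subst has_derivative_pd[OF has_derivative_exp_comp[OF assms]]) (simp add: pd_def)

lemma Ck_fun_const: "Ck_fun k (\<lambda>p :: real ^ 'n::finite. c)"
proof (induction k arbitrary: c)
  case (Suc k)
  have "pd i (\<lambda>p :: real ^ 'n. c) = (\<lambda>p. 0)" for i by (simp add: fun_eq_iff)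
  then show ?case using Suc by (simp add: Ck_fun_Suc_pd)
qed simp

lemma smooth_fun_const [intro!]: "smooth_fun (\<lambda>p. c)"
  by (simp add: smooth_fun_def Ck_fun_const)

lemma smooth_fun_coord [intro!]: "smooth_fun (\<lambda>p :: real ^ 'n::finite. p $ j)"
proof -
  have "pd i (\<lambda>q :: real ^ 'n. q $ j) = (\<lambda>p. if i = j then 1 else 0)" for i :: 'n and j
    by (simp add: fun_eq_iff pd_coord)
  then show ?thesis
    by (subst smooth_fun_pd_iff) auto
qed

lemma Ck_fun_add: "Ck_fun k f \<Longrightarrow> Ck_fun k g \<Longrightarrow> Ck_fun k (\<lambda>p. f p + g p)"
proof (induction k arbitrary: f g)
  case (Suc k)
  then have "pd i (\<lambda>p. f p + g p) = (\<lambda>p. pd i f p + pd i g p)" for i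
    by (auto simp: fun_eq_iff Ck_fun_Suc_pd intro!: pd_add)
  then show ?case using Suc by (simp add: Ck_fun_Suc_pd)
qed (simp add: continuous_on_add)

text \<open>The Leibniz rule leaves one factor undifferentiated in each term.
  \<open>Ck_fun_SucD\<close> lowers that factor to order \<open>k\<close>, so that the induction
  hypothesis, taken for arbitrary factors, applies.\<close>

lemma Ck_fun_mult: "Ck_fun k f \<Longrightarrow> Ck_fun k g \<Longrightarrow> Ck_fun k (\<lambda>p. f p * g p)"
proof (induction k arbitrary: f g)
  case (Suc k)
  then have "pd i (\<lambda>p. f p * g p) = (\<lambda>p. f p * pd i g p + pd i f p * g p)" for i
    by (auto simp: fun_eq_iff Ck_fun_Suc_pd intro!: pd_mult)
  moreover have "Ck_fun k f" "Ck_fun k g" using Suc.prems Ck_fun_SucD by auto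
  ultimately show ?case using Suc by (simp add: Ck_fun_Suc_pd Ck_fun_add)
qed (simp add: continuous_on_mult)

lemma Ck_fun_exp: "Ck_fun k f \<Longrightarrow> Ck_fun k (\<lambda>p. exp (f p))"
proof (induction k arbitrary: f)
  case (Suc k)
  then have "pd i (\<lambda>p. exp (f p)) = (\<lambda>p. exp (f p) * pd i f p)" for i
    by (auto simp: fun_eq_iff Ck_fun_Suc_pd intro!: pd_exp)
  moreover have "(\<lambda>p. exp (f p)) differentiable (at p)" for p
    using has_derivative_exp_comp Suc.prems unfolding Ck_fun_Suc_pd differentiable_def by blast
  ultimately show ?case using Suc Ck_fun_SucD[OF Suc.prems] by (simp add: Ck_fun_Suc_pd Ck_fun_mult)
qed (auto intro: continuous_intros)

lemma smooth_fun_add [intro!]: "smooth_fun f \<Longrightarrow> smooth_fun g \<Longrightarrow> smooth_fun (\<lambda>p. f p + g p)"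
  by (simp add: smooth_fun_def Ck_fun_add)

lemma smooth_fun_mult [intro!]: "smooth_fun f \<Longrightarrow> smooth_fun g \<Longrightarrow> smooth_fun (\<lambda>p. f p * g p)"
  by (simp add: smooth_fun_def Ck_fun_mult)

lemma smooth_fun_exp [intro!]: "smooth_fun f \<Longrightarrow> smooth_fun (\<lambda>p. exp (f p))"
  by (simp add: smooth_fun_def Ck_fun_exp)

lemma smooth_fun_minus [intro!]: "smooth_fun f \<Longrightarrow> smooth_fun (\<lambda>p. - f p)"
  using smooth_fun_mult[OF smooth_fun_const[of "-1"]] by simp

lemma smooth_fun_diff [intro!]: "smooth_fun f \<Longrightarrow> smooth_fun g \<Longrightarrow> smooth_fun (\<lambda>p. f p - g p)"
  using smooth_fun_add[OF _ smooth_fun_minus] by fastforce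

lemma smooth_fun_sum [intro!]:
  "finite I \<Longrightarrow> (\<And>i. i \<in> I \<Longrightarrow> smooth_fun (f i)) \<Longrightarrow> smooth_fun (\<lambda>p. \<Sum>i\<in>I. f i p)"
  by (induction I rule: finite_induct) auto

section \<open>Vector fields as derivations\<close>

lemma vf_apply_pd:
  fixes f :: "real ^ 'n::finite \<Rightarrow> real"
  assumes "f differentiable (at p)"
  shows "vf_apply X f p = (\<Sum>i\<in>UNIV. X p $ i * pd i f p)"
proof -
  interpret linear "frechet_derivative f (at p)"
    by (rule linear_frechet_derivative[OF assms])
  have "vf_apply X f p = frechet_derivative f (at p) (\<Sum>i\<in>UNIV. X p $ i *\<^sub>R axis i 1)"
    by (simp add: vf_apply_def basis_expansion flip: scalar_mult_eq_scaleR)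
  then show ?thesis by (simp add: sum scaleR pd_def)
qed

lemma smooth_vfD: "smooth_vf X \<Longrightarrow> smooth_fun (\<lambda>p. X p $ i)"
  by (simp add: smooth_vf_def)

lemma smooth_fun_vf_apply [intro!]:
  assumes "smooth_vf X" "smooth_fun f"
  shows "smooth_fun (vf_apply X f)"
proof -
  have "vf_apply X f = (\<lambda>p. \<Sum>i\<in>UNIV. X p $ i * pd i f p)"
    by (simp add: fun_eq_iff vf_apply_pd smooth_fun_differentiable assms)
  then show ?thesis using assms by (auto intro: smooth_vfD smooth_fun_pd)
qed

lemma smooth_vf_lie_bracket:
  "smooth_vf X \<Longrightarrow> smooth_vf Y \<Longrightarrow> smooth_vf (lie_bracket X Y)"
  by (auto simp: smooth_vf_def lie_bracket_def intro!: smooth_fun_diff smooth_fun_vf_apply)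

lemma vf_apply_const [simp]: "vf_apply X (\<lambda>p. c) p = 0"
  by (simp add: vf_apply_def)

lemma vf_apply_add:
  assumes "smooth_fun f" "smooth_fun g"
  shows "vf_apply X (\<lambda>q. f q + g q) p = vf_apply X f p + vf_apply X g p"
  by (simp add: vf_apply_def frechet_derivative_at[OF has_derivative_add[OF
      smooth_fun_has_derivative[OF assms(1)] smooth_fun_has_derivative[OF assms(2)]], symmetric])

lemma vf_apply_diff:
  assumes "smooth_fun f" "smooth_fun g"
  shows "vf_apply X (\<lambda>q. f q - g q) p = vf_apply X f p - vf_apply X g p"
  by (simp add: vf_apply_def frechet_derivative_at[OF has_derivative_diff[OF
      smooth_fun_has_derivative[OF assms(1)] smooth_fun_has_derivative[OF assms(2)]], symmetric])

lemma vf_apply_mult: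
  assumes "smooth_fun f" "smooth_fun g"
  shows "vf_apply X (\<lambda>q. f q * g q) p = f p * vf_apply X g p + vf_apply X f p * g p"
  by (simp add: vf_apply_def frechet_derivative_at[OF has_derivative_mult[OF
      smooth_fun_has_derivative[OF assms(1)] smooth_fun_has_derivative[OF assms(2)]], symmetric])

lemma vf_apply_exp:
  "smooth_fun f \<Longrightarrow> vf_apply X (\<lambda>q. exp (f q)) p = exp (f p) * vf_apply X f p"
  by (simp add: vf_apply_def smooth_fun_differentiable
      frechet_derivative_at[OF has_derivative_exp_comp, symmetric])

lemma vf_apply_coord: "vf_apply X (\<lambda>q. q $ j) p = X p $ j"
  by (simp add: vf_apply_def frechet_derivative_at[OF bounded_linear.has_derivative[OF bounded_linear_vec_nth has_derivative_ident], symmetric])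

text \<open>In coordinates, \<open>X(Y(f))\<close> splits into first-order terms and a double sum of
  second derivatives of \<open>f\<close>. By \<open>smooth_pd_commute\<close> the double sums for
  both orders agree, and the remaining first-order terms are the bracket.\<close>

lemma vf_apply_commutator:
  fixes f :: "real ^ 'n::finite \<Rightarrow> real"
  assumes X: "smooth_vf X" and Y: "smooth_vf Y" and f: "smooth_fun f"
  shows "vf_apply X (vf_apply Y f) p - vf_apply Y (vf_apply X f) p = vf_apply (lie_bracket X Y) f p"
proof -
  have expand: "vf_apply X (vf_apply Y f) p =
      (\<Sum>j\<in>UNIV. vf_apply X (\<lambda>q. Y q $ j) p * pd j f p)
        + (\<Sum>i\<in>UNIV. \<Sum>j\<in>UNIV. X p $ i * Y p $ j * pd i (pd j f) p)"
    if X: "smooth_vf X" and Y: "smooth_vf Y" for X Y :: "'n vector_field"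
  proof -
    have sm: "smooth_fun (\<lambda>q. Y q $ j * pd j f q)" for j
      using Y f by (auto intro: smooth_vfD smooth_fun_pd)
    have "vf_apply Y f = (\<lambda>q. \<Sum>j\<in>UNIV. Y q $ j * pd j f q)"
      by (simp add: fun_eq_iff vf_apply_pd smooth_fun_differentiable f)
    then have "vf_apply X (vf_apply Y f) p = frechet_derivative (\<lambda>q. \<Sum>j\<in>UNIV. Y q $ j * pd j f q) (at p) (X p)"
      by (simp add: vf_apply_def)
    also have "\<dots> = (\<Sum>j\<in>UNIV. vf_apply X (\<lambda>q. Y q $ j * pd j f q) p)"
      by (subst frechet_derivative_at[OF has_derivative_sum[OF smooth_fun_has_derivative[OF sm]], symmetric])
         (simp add: vf_apply_def)
    also have "\<dots> = (\<Sum>j\<in>UNIV. Y p $ j * vf_apply X (pd j f) p + vf_apply X (\<lambda>q. Y q $ j) p * pd j f p)"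
      by (intro sum.cong refl vf_apply_mult smooth_vfD Y smooth_fun_pd f)
    also have "\<dots> = (\<Sum>j\<in>UNIV. vf_apply X (\<lambda>q. Y q $ j) p * pd j f p)
        + (\<Sum>j\<in>UNIV. \<Sum>i\<in>UNIV. X p $ i * Y p $ j * pd i (pd j f) p)"
      by (simp add: vf_apply_pd smooth_fun_differentiable smooth_fun_pd f sum.distrib sum_distrib_left mult.left_commute mult.assoc add.commute)
    also have "(\<Sum>j\<in>UNIV. \<Sum>i\<in>UNIV. X p $ i * Y p $ j * pd i (pd j f) p)
        = (\<Sum>i\<in>UNIV. \<Sum>j\<in>UNIV. X p $ i * Y p $ j * pd i (pd j f) p)"
      by (rule sum.swap)
    finally show ?thesis .
  qed
  have "(\<Sum>i\<in>UNIV. \<Sum>j\<in>UNIV. X p $ i * Y p $ j * pd i (pd j f) p)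
      = (\<Sum>i\<in>UNIV. \<Sum>j\<in>UNIV. Y p $ i * X p $ j * pd i (pd j f) p)"
    by (subst sum.swap) (simp add: smooth_pd_commute[OF f] mult.commute)
  then have "vf_apply X (vf_apply Y f) p - vf_apply Y (vf_apply X f) p
      = (\<Sum>j\<in>UNIV. (vf_apply X (\<lambda>q. Y q $ j) p - vf_apply Y (\<lambda>q. X q $ j) p) * pd j f p)"
    by (simp add: expand X Y left_diff_distrib sum_subtractf)
  also have "\<dots> = vf_apply (lie_bracket X Y) f p"
    by (subst vf_apply_pd[OF smooth_fun_differentiable[OF f]]) (simp add: lie_bracket_def)
  finally show ?thesis .
qed

subsection \<open>Uniqueness of the Levi-Civita connection\<close>

lemma smooth_vf_const [intro!]: "smooth_vf (\<lambda>p. v)"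
  by (auto simp: smooth_vf_def)

lemma levi_civita_unique:
  fixes g :: "'n::finite tensor02"
  assumes g: "riemannian_metric g" and D: "levi_civita g D" and D': "levi_civita g D'"
    and X: "smooth_vf X" and Y: "smooth_vf Y"
  shows "D X Y = D' X Y"
proof
  fix p
  have bil: "bilinear (g p)" and sy: "g p u v = g p v u" and pos: "u \<noteq> 0 \<Longrightarrow> g p u u > 0" for u v
    using g by (auto simp: riemannian_metric_def)
  \<comment> \<open>\<open>T\<close> is symmetric in its first two arguments and skew in its last two, hence zero.\<close>
  define T where "T X Y Z = g p (D X Y p - D' X Y p) (Z p)" for X Y Z
  have 1: "T X Y Z = T Y X Z" if "smooth_vf X" "smooth_vf Y" for X Y Z
  proof -
    have "D X Y p - D Y X p = D' X Y p - D' Y X p"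
      using D D' that by (simp add: levi_civita_def)
    then have "D X Y p - D' X Y p = D Y X p - D' Y X p" by (simp add: algebra_simps)
    then show ?thesis by (simp add: T_def)
  qed
  have 2: "T X Y Z = - T X Z Y" if "smooth_vf X" "smooth_vf Y" "smooth_vf Z" for X Y Z
  proof -
    have "g p (D X Y p) (Z p) + g p (Y p) (D X Z p) = vf_apply X (\<lambda>q. g q (Y q) (Z q)) p"
      using D that by (simp add: levi_civita_def)
    also have "\<dots> = g p (D' X Y p) (Z p) + g p (Y p) (D' X Z p)"
      using D' that by (simp add: levi_civita_def)
    finally show ?thesis
      by (simp add: T_def bilinear_lsub[OF bil] sy[of "Y p" "D X Z p"] sy[of "Y p" "D' X Z p"])
  qed
  \<comment> \<open>The constant field whose value is the difference vector at \<open>p\<close> is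
    an admissible third argument, and it turns \<open>T X Y\<close> into the squared length of that
    vector. The chain below alternates both symmetries and changes sign three times.\<close>
  let ?S = "D X Y p - D' X Y p"
  have Z: "smooth_vf (\<lambda>_. ?S)" by auto
  let ?Z = "\<lambda>_ :: real ^ 'n. ?S"
  have "T X Y ?Z = - T X ?Z Y" by (rule 2[OF X Y Z])
  also have "\<dots> = - T ?Z X Y" using 1[OF X Z] by simp
  also have "\<dots> = T ?Z Y X" using 2[OF Z X Y] by simp
  also have "\<dots> = T Y ?Z X" by (rule 1[OF Z Y])
  also have "\<dots> = - T Y X ?Z" by (rule 2[OF Y Z X])
  also have "\<dots> = - T X Y ?Z" using 1[OF X Y] by simp
  finally have "g p ?S ?S = 0" by (simp add: T_def)
  then have "?S = 0" using pos[of ?S] by force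
  then show "D X Y p = D' X Y p" by simp
qed

subsection \<open>Curvature of the Sol metric\<close>

lemma vf_apply_minus: "smooth_fun f \<Longrightarrow> vf_apply X (\<lambda>q. - f q) p = - vf_apply X f p"
  using vf_apply_mult[OF smooth_fun_const[of "-1"]] by simp

lemma vf_apply_field_add:
  "smooth_fun f \<Longrightarrow> vf_apply (\<lambda>q. X q + X' q) f p = vf_apply X f p + vf_apply X' f p"
  by (simp add: vf_apply_pd smooth_fun_differentiable distrib_right sum.distrib)

lemma vf_apply_field_scaleR:
  "smooth_fun f \<Longrightarrow> vf_apply (\<lambda>q. h q *\<^sub>R X q) f p = h p * vf_apply X f p"
  by (simp add: vf_apply_pd smooth_fun_differentiable sum_distrib_left mult.assoc)

lemma lie_bracket_nth:
  "lie_bracket X Y p $ i = vf_apply X (\<lambda>q. Y q $ i) p - vf_apply Y (\<lambda>q. X q $ i) p"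
  by (simp add: lie_bracket_def)

lemma smooth_vf_scaleR: "smooth_fun f \<Longrightarrow> smooth_vf X \<Longrightarrow> smooth_vf (\<lambda>p. f p *\<^sub>R X p)"
  by (auto simp: smooth_vf_def)

lemmas vf_apply_rules =
  vf_apply_add vf_apply_diff vf_apply_mult vf_apply_exp vf_apply_coord
  vf_apply_minus smooth_fun_minus smooth_fun_add smooth_fun_diff smooth_fun_mult smooth_fun_exp smooth_fun_coord
  smooth_fun_const smooth_fun_vf_apply smooth_vfD

lemma riemannian_sol_metric: "riemannian_metric (sol_metric m n)"
  unfolding riemannian_metric_def
proof (intro conjI allI impI)
  fix p u v :: "real ^ 3" and i j :: 3
  show "bilinear (sol_metric m n p)"
    by (auto simp: bilinear_def linear_iff sol_metric_def algebra_simps)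
  show "sol_metric m n p u v = sol_metric m n p v u"
    by (simp add: sol_metric_def)
  show "smooth_fun (\<lambda>p. sol_metric m n p (axis i 1) (axis j 1))"
    unfolding sol_metric_def by (intro smooth_fun_add smooth_fun_mult smooth_fun_exp smooth_fun_const smooth_fun_coord)
  assume "u \<noteq> 0"
  have nn: "0 \<le> exp (- 2 * m * p $ 3) * (u $ 1 * u $ 1)" "0 \<le> exp (2 * n * p $ 3) * (u $ 2 * u $ 2)"
    "0 \<le> u $ 3 * u $ 3"
    by simp_all
  moreover have "0 < exp (- 2 * m * p $ 3) * (u $ 1 * u $ 1) \<or> 0 < exp (2 * n * p $ 3) * (u $ 2 * u $ 2)
      \<or> 0 < u $ 3 * u $ 3"
    using \<open>u \<noteq> 0\<close> by (auto simp: vec_eq_iff forall_3 zero_less_mult_iff not_less)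
  ultimately show "0 < sol_metric m n p u u"
    unfolding sol_metric_def mult.assoc by linarith
qed

text \<open>The nonzero Christoffel symbols are \<open>\<Gamma>\<^sup>1\<^sub>1\<^sub>3 = - m\<close>, \<open>\<Gamma>\<^sup>2\<^sub>2\<^sub>3 = n\<close>,
  \<open>\<Gamma>\<^sup>3\<^sub>1\<^sub>1 = m e\<^sup>-\<^sup>2\<^sup>m\<^sup>t\<close>, \<open>\<Gamma>\<^sup>3\<^sub>2\<^sub>2 = - n e\<^sup>2\<^sup>n\<^sup>t\<close>.\<close>

definition sol_conn :: "real \<Rightarrow> real \<Rightarrow> 3 vector_field \<Rightarrow> 3 vector_field \<Rightarrow> 3 vector_field" where
  "sol_conn m n X Y = (\<lambda>p. vector
     [vf_apply X (\<lambda>q. Y q $ 1) p - m * (X p $ 1 * Y p $ 3 + X p $ 3 * Y p $ 1),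
      vf_apply X (\<lambda>q. Y q $ 2) p + n * (X p $ 2 * Y p $ 3 + X p $ 3 * Y p $ 2),
      vf_apply X (\<lambda>q. Y q $ 3) p + m * exp (- 2 * m * p $ 3) * X p $ 1 * Y p $ 1
        - n * exp (2 * n * p $ 3) * X p $ 2 * Y p $ 2])"

lemma smooth_sol_conn:
  assumes "smooth_vf X" "smooth_vf Y"
  shows "smooth_vf (sol_conn m n X Y)"
  unfolding smooth_vf_def forall_3 sol_conn_def vector_3
  by (simp add: vf_apply_rules assms)

lemma affine_sol_conn: "affine_connection (sol_conn m n)"
  unfolding affine_connection_def
  by (simp add: smooth_sol_conn)
    (simp add: fun_eq_iff vec_eq_iff forall_3 sol_conn_def vector_3 vf_apply_rules
      vf_apply_field_add vf_apply_field_scaleR algebra_simps)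

lemma levi_civita_sol_conn: "levi_civita (sol_metric m n) (sol_conn m n)"
  unfolding levi_civita_def
proof (intro conjI allI impI affine_sol_conn)
  fix X Y Z :: "3 vector_field" and p
  assume sm: "smooth_vf X" "smooth_vf Y"
  show "sol_conn m n X Y p - sol_conn m n Y X p = lie_bracket X Y p"
    by (simp add: vec_eq_iff forall_3 sol_conn_def vector_3 lie_bracket_nth algebra_simps)
  assume "smooth_vf Z"
  then show "vf_apply X (\<lambda>q. sol_metric m n q (Y q) (Z q)) p =
     sol_metric m n p (sol_conn m n X Y p) (Z p) + sol_metric m n p (Y p) (sol_conn m n X Z p)"
    by (simp add: sol_metric_def sol_conn_def vector_3 vf_apply_rules sm) (simp add: algebra_simps)
qed

text \<open>Uniqueness replaces \<open>D\<close> by the explicit \<open>sol_conn\<close>, all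
  arguments that occur being smooth. All derivatives of \<open>X\<close>, \<open>Y\<close> and
  \<open>Z\<close> then cancel, which leaves an expression in their values at
  \<open>p\<close>.\<close>

lemma sol_curvature:
  assumes D: "levi_civita (sol_metric m n) D"
    and sm: "smooth_vf X" "smooth_vf Y" "smooth_vf Z"
  shows "curvature D X Y Z p = vector
    [m * n * exp (2 * n * p $ 3) * (X p $ 1 * Y p $ 2 - X p $ 2 * Y p $ 1) * Z p $ 2
       - m\<^sup>2 * (X p $ 1 * Y p $ 3 - X p $ 3 * Y p $ 1) * Z p $ 3,
     m * n * exp (- 2 * m * p $ 3) * (X p $ 2 * Y p $ 1 - X p $ 1 * Y p $ 2) * Z p $ 1
       - n\<^sup>2 * (X p $ 2 * Y p $ 3 - X p $ 3 * Y p $ 2) * Z p $ 3,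
     - m\<^sup>2 * exp (- 2 * m * p $ 3) * (X p $ 3 * Y p $ 1 - X p $ 1 * Y p $ 3) * Z p $ 1
       - n\<^sup>2 * exp (2 * n * p $ 3) * (X p $ 3 * Y p $ 2 - X p $ 2 * Y p $ 3) * Z p $ 2]"
    (is "_ = ?R")
proof -
  have eq: "D U V = sol_conn m n U V" if "smooth_vf U" "smooth_vf V" for U V
    using levi_civita_unique[OF riemannian_sol_metric D levi_civita_sol_conn that] .
  have "curvature D X Y Z p = curvature (sol_conn m n) X Y Z p"
    by (simp add: curvature_def eq sm smooth_sol_conn smooth_vf_lie_bracket)
  \<comment> \<open>This is the only analytic input: the bracket term it produces cancels the
    derivative part of \<open>D (lie_bracket X Y) Z\<close>.\<close>
  moreover have comm: "vf_apply X (vf_apply Y (\<lambda>q. Z q $ i)) p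
      = vf_apply Y (vf_apply X (\<lambda>q. Z q $ i)) p + vf_apply (lie_bracket X Y) (\<lambda>q. Z q $ i) p" for i
    using vf_apply_commutator[OF sm(1,2) smooth_vfD[OF sm(3)], of i p] by simp
  have "curvature (sol_conn m n) X Y Z p $ 1 = ?R $ 1"
    by (simp add: curvature_def sol_conn_def vector_3 vf_apply_rules sm comm lie_bracket_nth)
      (simp add: algebra_simps power2_eq_square)
  moreover have "curvature (sol_conn m n) X Y Z p $ 2 = ?R $ 2"
    by (simp add: curvature_def sol_conn_def vector_3 vf_apply_rules sm comm lie_bracket_nth)
      (simp add: algebra_simps power2_eq_square)
  moreover have "curvature (sol_conn m n) X Y Z p $ 3 = ?R $ 3"
    by (simp add: curvature_def sol_conn_def vector_3 vf_apply_rules sm comm lie_bracket_nth)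
      (simp add: algebra_simps power2_eq_square)
  ultimately show ?thesis by (simp add: vec_eq_iff forall_3)
qed

section \<open>The Ricci tensor and the frame sums\<close>

text \<open>The rescaled components of the frame form an orthogonal matrix \<open>M\<close>; the sums are the entries of
  \<open>M M\<^sup>T = 1\<close>.\<close>

lemma sol_orthonormal_frame_sums:
  assumes "orthonormal_frame (sol_metric m n) E"
  defines "S \<equiv> \<lambda>p a b. \<Sum>i\<in>UNIV. E i p $ a * E i p $ b"
  shows "exp (- 2 * m * p $ 3) * S p 1 1 = 1" "exp (2 * n * p $ 3) * S p 2 2 = 1" "S p 3 3 = 1"
    "S p 1 2 = 0" "S p 1 3 = 0" "S p 2 3 = 0"
proof -
  let ?w = "\<lambda>a::3. if a = 1 then exp (- m * p $ 3) else if a = 2 then exp (n * p $ 3) else 1"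
  define M :: "real ^ 3 ^ 3" where "M = (\<chi> a i. ?w a * E i p $ a)"
  have sq: "exp (- 2 * m * p $ 3) = exp (- m * p $ 3) * exp (- m * p $ 3)"
    "exp (2 * n * p $ 3) = exp (n * p $ 3) * exp (n * p $ 3)"
    by (simp_all add: exp_add[symmetric])
  have "(transpose M ** M) $ i $ j = sol_metric m n p (E i p) (E j p)" for i j
    unfolding sol_metric_def sq
    by (simp add: matrix_matrix_mult_def transpose_def M_def sum_3 mult_ac)
  then have "transpose M ** M = mat 1"
    using assms(1) by (simp add: vec_eq_iff mat_def orthonormal_frame_def)
  \<comment> \<open>For a square matrix a left inverse is a right inverse; this turns orthonormality
    of the frame vectors into relations between components summed over the frame.\<close>
  then have "M ** transpose M = mat 1"
    by (simp add: matrix_left_right_inverse)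
  moreover have "(M ** transpose M) $ a $ b = ?w a * ?w b * S p a b" for a b
    by (simp add: matrix_matrix_mult_def transpose_def M_def S_def sum_distrib_left mult_ac)
  ultimately have *: "?w a * ?w b * S p a b = (if a = b then 1 else 0)" for a b
    by (simp add: mat_def flip: \<open>\<And>b a. _ = ?w a * ?w b * S p a b\<close>)
  show "exp (- 2 * m * p $ 3) * S p 1 1 = 1" "exp (2 * n * p $ 3) * S p 2 2 = 1" "S p 3 3 = 1"
    "S p 1 2 = 0" "S p 1 3 = 0" "S p 2 3 = 0"
    using *[of 1 1] *[of 2 2] *[of 3 3] *[of 1 2] *[of 1 3] *[of 2 3] unfolding sq by simp_all
qed

text \<open>The trace of the curvature involves the frame only through the sums of
  \<open>sol_orthonormal_frame_sums\<close>, which are the entries of the inverse metric; hence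
  \<open>E\<close> disappears from the result.\<close>

lemma sol_ricci:
  assumes D: "levi_civita (sol_metric m n) D" and E: "orthonormal_frame (sol_metric m n) E"
    and sm: "smooth_vf X" "smooth_vf Y"
  shows "ricci (sol_metric m n) D E X Y p =
    (m * n - m\<^sup>2) * (exp (- 2 * m * p $ 3) * X p $ 1 * Y p $ 1)
    + (m * n - n\<^sup>2) * (exp (2 * n * p $ 3) * X p $ 2 * Y p $ 2)
    - (m\<^sup>2 + n\<^sup>2) * (X p $ 3 * Y p $ 3)"
proof -
  define S where "S a b = (\<Sum>i\<in>UNIV. E i p $ a * E i p $ b)" for a b
  define A B where "A = exp (- 2 * m * p $ 3)" and "B = exp (2 * n * p $ 3)"
  define x where "x = (\<lambda>i. X p $ i)"
  define y where "y = (\<lambda>i. Y p $ i)"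
  note S = sol_orthonormal_frame_sums[OF E, of p, folded A_def B_def S_def]
  have smE: "smooth_vf (E i)" for i using E by (simp add: orthonormal_frame_def)
  have "ricci (sol_metric m n) D E X Y p =
      A * y 1 * (m * n * B * (x 1 * S 2 2 - x 2 * S 1 2) - m\<^sup>2 * (x 1 * S 3 3 - x 3 * S 1 3))
    + B * y 2 * (m * n * A * (x 2 * S 1 1 - x 1 * S 1 2) - n\<^sup>2 * (x 2 * S 3 3 - x 3 * S 2 3))
    + y 3 * (- m\<^sup>2 * A * (x 3 * S 1 1 - x 1 * S 1 3) - n\<^sup>2 * B * (x 3 * S 2 2 - x 2 * S 2 3))"
    unfolding ricci_def sol_curvature[OF D sm(1) smE smE] sol_metric_def vector_3
      A_def[symmetric] B_def[symmetric] S_def sum_3 x_def[symmetric] y_def[symmetric]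
    by (simp add: x_def y_def algebra_simps)
  \<comment> \<open>Mixed sums vanish and \<open>S 3 3 = 1\<close>. The products
    \<open>B * S 2 2\<close> and \<open>A * S 1 1\<close> are kept together because each equals
    \<open>1\<close>.\<close>
  also have "\<dots> = m * n * x 1 * y 1 * A * (B * S 2 2) - m\<^sup>2 * A * x 1 * y 1
      + m * n * x 2 * y 2 * B * (A * S 1 1) - n\<^sup>2 * B * x 2 * y 2
      - m\<^sup>2 * x 3 * y 3 * (A * S 1 1) - n\<^sup>2 * x 3 * y 3 * (B * S 2 2)"
    by (simp add: S(3-6) algebra_simps)
  finally show ?thesis
    by (simp only: S(1,2)) (simp add: A_def B_def x_def y_def algebra_simps)
qed

section \<open>The soliton equation in coordinates\<close>

text \<open>The derivatives of the components of \<open>X\<close> and \<open>Y\<close> along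
  \<open>\<xi>\<close> cancel against those in the brackets. The terms with
  \<open>\<xi> p $ 3\<close> come from differentiating the exponential metric coefficients.\<close>

lemma sol_lie_derivative_metric:
  assumes "smooth_vf \<xi>" "smooth_vf X" "smooth_vf Y"
  shows "lie_derivative_metric (sol_metric m n) \<xi> X Y p =
    exp (- 2 * m * p $ 3) * (vf_apply X (\<lambda>q. \<xi> q $ 1) p * Y p $ 1 + X p $ 1 * vf_apply Y (\<lambda>q. \<xi> q $ 1) p
        - 2 * m * \<xi> p $ 3 * X p $ 1 * Y p $ 1)
    + exp (2 * n * p $ 3) * (vf_apply X (\<lambda>q. \<xi> q $ 2) p * Y p $ 2 + X p $ 2 * vf_apply Y (\<lambda>q. \<xi> q $ 2) p
        + 2 * n * \<xi> p $ 3 * X p $ 2 * Y p $ 2)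
    + (vf_apply X (\<lambda>q. \<xi> q $ 3) p * Y p $ 3 + X p $ 3 * vf_apply Y (\<lambda>q. \<xi> q $ 3) p)"
  by (simp add: lie_derivative_metric_def sol_metric_def lie_bracket_nth vf_apply_rules assms)
    (simp add: algebra_simps)

text \<open>These are the components 11, 22, 33, 12, 13, 23 of the soliton equation. The diagonal
  ones are divided by the metric coefficient, the others multiplied by 2.\<close>

definition sol_soliton_eqs :: "real \<Rightarrow> real \<Rightarrow> 3 vector_field \<Rightarrow> real \<Rightarrow> real ^ 3 \<Rightarrow> bool" where
  "sol_soliton_eqs m n \<xi> c p \<longleftrightarrow>
     m * n - m\<^sup>2 - m * \<xi> p $ 3 + pd 1 (\<lambda>q. \<xi> q $ 1) p = c \<and>
     m * n - n\<^sup>2 + n * \<xi> p $ 3 + pd 2 (\<lambda>q. \<xi> q $ 2) p = c \<and>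
     - m\<^sup>2 - n\<^sup>2 + pd 3 (\<lambda>q. \<xi> q $ 3) p = c \<and>
     exp (- 2 * m * p $ 3) * pd 2 (\<lambda>q. \<xi> q $ 1) p + exp (2 * n * p $ 3) * pd 1 (\<lambda>q. \<xi> q $ 2) p = 0 \<and>
     exp (- 2 * m * p $ 3) * pd 3 (\<lambda>q. \<xi> q $ 1) p + pd 1 (\<lambda>q. \<xi> q $ 3) p = 0 \<and>
     exp (2 * n * p $ 3) * pd 3 (\<lambda>q. \<xi> q $ 2) p + pd 2 (\<lambda>q. \<xi> q $ 3) p = 0"

lemma orthonormal_frame_sol:
  "orthonormal_frame (sol_metric m n)
     (\<lambda>i. if i = 1 then sol_e1 m n else if i = 2 then sol_e2 m n else sol_e3 m n)"
proof -
  have "smooth_vf (sol_e1 m n)" "smooth_vf (sol_e2 m n)" "smooth_vf (sol_e3 m n)"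
    unfolding sol_e1_def[abs_def] sol_e2_def[abs_def] sol_e3_def[abs_def]
    by (intro smooth_vf_const smooth_vf_scaleR smooth_fun_exp smooth_fun_mult smooth_fun_const smooth_fun_coord)+
  moreover have "sol_metric m n p u v = sol_metric m n p v u" for p u v
    by (simp add: sol_metric_def)
  ultimately show ?thesis
    by (auto simp: orthonormal_frame_def forall_3 sol_frame_orthonormal)
qed

text \<open>Forwards, the equation is tested on the constant coordinate fields. Backwards,
  \<open>sol_conn\<close> and the left-invariant frame serve as witnesses, and tensoriality extends
  the six equations to all fields.\<close>

lemma sol_ricci_soliton_iff:
  assumes \<xi>: "smooth_vf \<xi>"
  shows "ricci_soliton (sol_metric m n) \<xi> c \<longleftrightarrow> (\<forall>p. sol_soliton_eqs m n \<xi> c p)"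
proof
  assume "ricci_soliton (sol_metric m n) \<xi> c"
  then obtain D E where D: "levi_civita (sol_metric m n) D" and E: "orthonormal_frame (sol_metric m n) E"
    and eq: "\<And>X Y p. smooth_vf X \<Longrightarrow> smooth_vf Y \<Longrightarrow>
      ricci (sol_metric m n) D E X Y p + 1/2 * lie_derivative_metric (sol_metric m n) \<xi> X Y p
        = c * sol_metric m n p (X p) (Y p)"
    unfolding ricci_soliton_def by blast
  show "\<forall>p. sol_soliton_eqs m n \<xi> c p"
  proof
    fix p
    have "vf_apply (\<lambda>_. axis i 1) f p = pd i f p" for i :: 3 and f
      by (simp add: vf_apply_def pd_def)
    note expand = eq[of "\<lambda>_. axis i 1" "\<lambda>_. axis j 1" p for i j, OF smooth_vf_const smooth_vf_const,
        unfolded sol_ricci[OF D E smooth_vf_const smooth_vf_const]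
          sol_lie_derivative_metric[OF \<xi> smooth_vf_const smooth_vf_const] this sol_metric_def axis_nth]
    have "exp (- 2 * m * p $ 3) * (m * n - m\<^sup>2 - m * \<xi> p $ 3 + pd 1 (\<lambda>q. \<xi> q $ 1) p)
        = exp (- 2 * m * p $ 3) * c"
      using expand[of 1 1] by (simp add: axis_def algebra_simps)
    moreover have "exp (2 * n * p $ 3) * (m * n - n\<^sup>2 + n * \<xi> p $ 3 + pd 2 (\<lambda>q. \<xi> q $ 2) p)
        = exp (2 * n * p $ 3) * c"
      using expand[of 2 2] by (simp add: axis_def algebra_simps)
    ultimately show "sol_soliton_eqs m n \<xi> c p"
      using expand[of 3 3] expand[of 1 2] expand[of 1 3] expand[of 2 3]
      by (simp add: sol_soliton_eqs_def axis_def)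
  qed
next
  assume eqs: "\<forall>p. sol_soliton_eqs m n \<xi> c p"
  let ?E = "\<lambda>i::3. if i = 1 then sol_e1 m n else if i = 2 then sol_e2 m n else sol_e3 m n"
  have "ricci (sol_metric m n) (sol_conn m n) ?E X Y p
      + 1/2 * lie_derivative_metric (sol_metric m n) \<xi> X Y p = c * sol_metric m n p (X p) (Y p)"
    if sm: "smooth_vf X" "smooth_vf Y" for X Y p
  proof -
    define A B where "A = exp (- 2 * m * p $ 3)" and "B = exp (2 * n * p $ 3)"
    define P where "P = (\<lambda>i j. pd i (\<lambda>q. \<xi> q $ j) p)"
    define x where "x = (\<lambda>i. X p $ i)"
    define y where "y = (\<lambda>i. Y p $ i)"
    have vf: "vf_apply Z (\<lambda>q. \<xi> q $ j) p = Z p $ 1 * P 1 j + Z p $ 2 * P 2 j + Z p $ 3 * P 3 j" for Z j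
      by (simp add: vf_apply_pd smooth_fun_differentiable smooth_vfD \<xi> P_def sum_3)
    have e: "m * n - m\<^sup>2 - m * \<xi> p $ 3 + P 1 1 - c = 0" "m * n - n\<^sup>2 + n * \<xi> p $ 3 + P 2 2 - c = 0"
      "- m\<^sup>2 - n\<^sup>2 + P 3 3 - c = 0"
      "A * P 2 1 + B * P 1 2 = 0" "A * P 3 1 + P 1 3 = 0" "B * P 3 2 + P 2 3 = 0"
      using eqs unfolding sol_soliton_eqs_def A_def B_def P_def by simp_all
    \<comment> \<open>The defect of the soliton equation is a combination of the six expressions in
      \<open>e\<close>, with coefficients bilinear in \<open>x\<close> and \<open>y\<close>.\<close>
    have "ricci (sol_metric m n) (sol_conn m n) ?E X Y p
        + 1/2 * lie_derivative_metric (sol_metric m n) \<xi> X Y p - c * sol_metric m n p (X p) (Y p)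
      = A * x 1 * y 1 * (m * n - m\<^sup>2 - m * \<xi> p $ 3 + P 1 1 - c)
        + B * x 2 * y 2 * (m * n - n\<^sup>2 + n * \<xi> p $ 3 + P 2 2 - c)
        + x 3 * y 3 * (- m\<^sup>2 - n\<^sup>2 + P 3 3 - c)
        + 1/2 * (x 1 * y 2 + x 2 * y 1) * (A * P 2 1 + B * P 1 2)
        + 1/2 * (x 1 * y 3 + x 3 * y 1) * (A * P 3 1 + P 1 3)
        + 1/2 * (x 2 * y 3 + x 3 * y 2) * (B * P 3 2 + P 2 3)"
      unfolding sol_ricci[OF levi_civita_sol_conn orthonormal_frame_sol sm]
        sol_lie_derivative_metric[OF \<xi> sm] sol_metric_def vf A_def[symmetric] B_def[symmetric]
      by (simp add: x_def y_def algebra_simps add_divide_distrib diff_divide_distrib)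
    then show ?thesis unfolding e by simp
  qed
  then show "ricci_soliton (sol_metric m n) \<xi> c"
    unfolding ricci_soliton_def
    using riemannian_sol_metric \<xi> levi_civita_sol_conn orthonormal_frame_sol by blast
qed

subsection \<open>Solving the soliton equations\<close>

lemma constant_derivative_affine:
  fixes f :: "real \<Rightarrow> real"
  assumes "\<And>t. (f has_real_derivative k) (at t)"
  shows "f t = f 0 + k * t"
proof -
  have "((\<lambda>t. f t - k * t) has_real_derivative 0) (at t)" for t
    by (auto intro!: derivative_eq_intros assms)
  then have "f t - k * t = f 0 - k * 0"
    using DERIV_isconst_all by blast
  then show ?thesis by simp
qed

text \<open>Differentiation removes \<open>Q\<close>. Comparing the resulting relation at
  \<open>t = 0\<close> and \<open>t = 1\<close> gives \<open>P = 0\<close>, since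
  \<open>exp (- 2 * m) < exp (2 * n)\<close>.\<close>

lemma exp_independent:
  fixes m n P Q R :: real
  assumes "m > 0" "n > 0"
    and zero: "\<And>t. exp (- 2 * m * t) * P + Q + exp (2 * n * t) * R = 0"
  shows "P = 0" "Q = 0" "R = 0"
proof -
  have "((\<lambda>t. exp (- 2 * m * t) * P + Q + exp (2 * n * t) * R) has_real_derivative
      2 * n * R * exp (2 * n * t) - 2 * m * P * exp (- 2 * m * t)) (at t)" for t
    by (auto intro!: derivative_eq_intros)
  then have "2 * n * R * exp (2 * n * t) - 2 * m * P * exp (- 2 * m * t) = 0" for t
    unfolding zero using DERIV_unique DERIV_const by blast
  then have d: "n * R * exp (2 * n * t) = m * P * exp (- 2 * m * t)" for t
    by (simp only: mult.assoc) simp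
  have "exp (- 2 * m) < exp (2 * n)" using assms by simp
  moreover have "m * P * (exp (2 * n) - exp (- 2 * m)) = 0"
    using d[of 0] d[of 1] by (simp add: right_diff_distrib)
  ultimately show "P = 0" using \<open>m > 0\<close> by simp
  then show "R = 0" using d[of 0] \<open>n > 0\<close> by simp
  with \<open>P = 0\<close> show "Q = 0" using zero[of 0] by simp
qed

text \<open>These are the soliton equations restricted to an \<open>(x,t)\<close>-plane (\<open>\<mu> = m\<close>) or a \<open>(y,t)\<close>-plane (\<open>\<mu> = - n\<close>).\<close>

lemma sol_planar_system:
  fixes f g ft gs :: "real \<Rightarrow> real \<Rightarrow> real"
  assumes "\<mu> \<noteq> 0"
    and fs: "\<And>s t. ((\<lambda>s. f s t) has_real_derivative \<mu> * g s t + a) (at s)"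
    and ft: "\<And>s t. (f s has_real_derivative ft s t) (at t)"
    and gs: "\<And>s t. ((\<lambda>s. g s t) has_real_derivative gs s t) (at s)"
    and gt: "\<And>s t. (g s has_real_derivative c) (at t)"
    and eq: "\<And>s t. exp (- 2 * \<mu> * t) * ft s t + gs s t = 0"
  obtains \<alpha> where "c = 0" "\<And>s t. g s t = g 0 0 + \<alpha> * s"
    "\<And>s t. f s t = f s 0 + (1 - exp (2 * \<mu> * t)) / (2 * \<mu>) * \<alpha>"
proof -
  have g: "g s t = g s 0 + c * t" for s t
    by (rule constant_derivative_affine[OF gt])
  have gs0: "gs s t = gs s 0" for s t
  proof -
    have "((\<lambda>s. g s 0 + c * t) has_real_derivative gs s 0 + 0) (at s)"
      by (intro DERIV_add gs DERIV_const)
    moreover have "(\<lambda>s. g s t) = (\<lambda>s. g s 0 + c * t)"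
      using g by blast
    ultimately have "((\<lambda>s. g s t) has_real_derivative gs s 0) (at s)"
      by simp
    then show ?thesis using gs DERIV_unique by blast
  qed
  have ft': "ft s t = - exp (2 * \<mu> * t) * gs s 0" for s t
  proof -
    have "exp (2 * \<mu> * t) * (exp (- 2 * \<mu> * t) * ft s t + gs s t) = ft s t + exp (2 * \<mu> * t) * gs s 0"
      by (simp add: distrib_left gs0[of s t] flip: exp_add mult.assoc)
    then show ?thesis unfolding eq by simp
  qed
  \<comment> \<open>By \<open>ft'\<close> the added term cancels the \<open>t\<close>-derivative of
    \<open>f\<close>; the value of the constant sum at \<open>t = 0\<close> produces the factor
    \<open>1 - exp (2 * \<mu> * t)\<close>.\<close>
  have f: "f s t = f s 0 + (1 - exp (2 * \<mu> * t)) / (2 * \<mu>) * gs s 0" for s t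
  proof -
    have "((\<lambda>t. exp (2 * \<mu> * t) / (2 * \<mu>)) has_real_derivative exp (2 * \<mu> * t)) (at t)" for t
      using \<open>\<mu> \<noteq> 0\<close> by (auto intro!: derivative_eq_intros)
    then have "((\<lambda>t. f s t + exp (2 * \<mu> * t) / (2 * \<mu>) * gs s 0) has_real_derivative
        ft s t + exp (2 * \<mu> * t) * gs s 0) (at t)" for t
      by (intro DERIV_add ft DERIV_cmult_right)
    then have "((\<lambda>t. f s t + exp (2 * \<mu> * t) / (2 * \<mu>) * gs s 0) has_real_derivative 0) (at t)" for t
      by (simp add: ft')
    from constant_derivative_affine[OF this, of t] show ?thesis
      by (simp add: diff_divide_distrib left_diff_distrib)
  qed
  \<comment> \<open>The left-hand side does not depend on \<open>t\<close>; comparing \<open>t = 1\<close> with \<open>t = - 1\<close> gives \<open>c = 0\<close>.\<close>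
  have K: "((\<lambda>s. gs s 0) has_real_derivative 2 * \<mu>\<^sup>2 * c * t / (1 - exp (2 * \<mu> * t))) (at s)"
    if "t \<noteq> 0" for s t
  proof -
    have ne: "1 - exp (2 * \<mu> * t) \<noteq> 0" using that \<open>\<mu> \<noteq> 0\<close> by simp
    \<comment> \<open>Solving the formula \<open>f\<close> for \<open>gs s 0\<close> at a fixed
      \<open>t \<noteq> 0\<close> writes it as a multiple of \<open>f s t - f s 0\<close>, whose
      \<open>s\<close>-derivative is known; \<open>a\<close> and \<open>g s 0\<close> drop out of
      it.\<close>
    have "((\<lambda>s. 2 * \<mu> / (1 - exp (2 * \<mu> * t)) * (f s t - f s 0)) has_real_derivative
        2 * \<mu> / (1 - exp (2 * \<mu> * t)) * ((\<mu> * g s t + a) - (\<mu> * g s 0 + a))) (at s)"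
      by (intro DERIV_cmult DERIV_diff fs)
    moreover have "(\<lambda>s. 2 * \<mu> / (1 - exp (2 * \<mu> * t)) * (f s t - f s 0)) = (\<lambda>s. gs s 0)"
      using ne \<open>\<mu> \<noteq> 0\<close> by (simp add: fun_eq_iff f[of _ t])
    moreover have "2 * \<mu> / (1 - exp (2 * \<mu> * t)) * ((\<mu> * g s t + a) - (\<mu> * g s 0 + a))
        = 2 * \<mu>\<^sup>2 * c * t / (1 - exp (2 * \<mu> * t))"
      by (simp add: g[of s t] power2_eq_square algebra_simps)
    ultimately show ?thesis by (simp only:)
  qed
  have "c = 0"
  proof (rule ccontr)
    assume "c \<noteq> 0"
    define d e k where "d = exp (2 * \<mu>)" and "e = exp (- 2 * \<mu>)" and "k = 2 * \<mu>\<^sup>2 * c"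
    have de: "d * e = 1" "1 - d \<noteq> 0" "1 - e \<noteq> 0" "k \<noteq> 0"
      using \<open>\<mu> \<noteq> 0\<close> \<open>c \<noteq> 0\<close> by (simp_all add: d_def e_def k_def flip: exp_add)
    have "k / (1 - d) = - k / (1 - e)"
      using DERIV_unique[OF K[of 1 0] K[of "-1" 0]] by (simp add: d_def e_def k_def)
    then have "k * (1 - e) = - k * (1 - d)"
      by (simp only: frac_eq_eq[OF de(2,3)])
    then have "k * (2 - d - e) = 0" by algebra
    then have "2 - d - e = 0" using de(4) by simp
    \<comment> \<open>Multiply \<open>2 - d - e = 0\<close> by \<open>d\<close> and use
      \<open>d * e = 1\<close>.\<close>
    then have "(1 - d)\<^sup>2 = 0" using de(1) by algebra
    then show False using de(2) by simp
  qed
  \<comment> \<open>With \<open>c = 0\<close> the derivative in \<open>K\<close> vanishes; the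
    constant \<open>gs 0 0\<close> is the slope \<alpha>.\<close>
  then have const: "gs s 0 = gs 0 0" for s
    using constant_derivative_affine[of "\<lambda>s. gs s 0" 0 s] K[of 1] by simp
  have "((\<lambda>s. g s 0) has_real_derivative gs 0 0) (at s)" for s
    using gs[of 0 s] const[of s] by simp
  note gs_affine = constant_derivative_affine[OF this]
  have "g s t = g 0 0 + gs 0 0 * s" for s t
    using g[of s t] gs_affine[of s] \<open>c = 0\<close> by simp
  moreover have "f s t = f s 0 + (1 - exp (2 * \<mu> * t)) / (2 * \<mu>) * gs 0 0" for s t
    using f[of s t] const[of s] by simp
  ultimately show ?thesis using that \<open>c = 0\<close> by blast
qed

text \<open>The planar system holds on each slice of constant \<open>y\<close> (with
  \<open>m\<close>) and of constant \<open>x\<close> (with \<open>- n\<close>). So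
  \<open>c = 0\<close> and \<open>w\<close> is affine in \<open>x\<close> and in \<open>y\<close>,
  with slopes \<open>\<alpha> y\<close> and \<open>\<beta> x\<close>. Equation \<open>xy\<close>
  then determines \<open>uy\<close> and \<open>vx\<close> at \<open>t = 0\<close>, after which
  \<open>ux\<close> and \<open>vy\<close> make \<open>w\<close> constant.\<close>

lemma sol_soliton_system:
  fixes u v w uy ut vx vt wx wy :: "real \<Rightarrow> real \<Rightarrow> real \<Rightarrow> real"
  assumes mn: "m > 0" "n > 0"
    and ux: "\<And>x y t. ((\<lambda>x. u x y t) has_real_derivative m * w x y t + a) (at x)"
    and uy: "\<And>x y t. ((\<lambda>y. u x y t) has_real_derivative uy x y t) (at y)"
    and ut: "\<And>x y t. (u x y has_real_derivative ut x y t) (at t)"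
    and vx: "\<And>x y t. ((\<lambda>x. v x y t) has_real_derivative vx x y t) (at x)"
    and vy: "\<And>x y t. ((\<lambda>y. v x y t) has_real_derivative - n * w x y t + b) (at y)"
    and vt: "\<And>x y t. (v x y has_real_derivative vt x y t) (at t)"
    and wx: "\<And>x y t. ((\<lambda>x. w x y t) has_real_derivative wx x y t) (at x)"
    and wy: "\<And>x y t. ((\<lambda>y. w x y t) has_real_derivative wy x y t) (at y)"
    and wt: "\<And>x y t. (w x y has_real_derivative c) (at t)"
    and xy: "\<And>x y t. exp (- 2 * m * t) * uy x y t + exp (2 * n * t) * vx x y t = 0"
    and xt: "\<And>x y t. exp (- 2 * m * t) * ut x y t + wx x y t = 0"
    and yt: "\<And>x y t. exp (2 * n * t) * vt x y t + wy x y t = 0"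
  obtains c1 c2 c3 where "c = 0" "\<And>x y t. w x y t = c1"
    "\<And>x y t. u x y t = (m * c1 + a) * x + c2" "\<And>x y t. v x y t = (b - n * c1) * y + c3"
proof -
  have "\<forall>y. \<exists>\<alpha>. c = 0 \<and> (\<forall>x t. w x y t = w 0 y 0 + \<alpha> * x) \<and>
      (\<forall>x t. u x y t = u x y 0 + (1 - exp (2 * m * t)) / (2 * m) * \<alpha>)"
    (is "\<forall>y. \<exists>\<alpha>. ?P y \<alpha>")
  proof
    fix y
    show "\<exists>\<alpha>. ?P y \<alpha>"
      by (rule sol_planar_system[where f = "\<lambda>x. u x y" and g = "\<lambda>x. w x y"
        and ft = "\<lambda>x. ut x y" and gs = "\<lambda>x. wx x y" and \<mu> = m, OF _ ux ut wx wt xt])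
        (use mn in simp, blast)
  qed
  from choice[OF this] obtain \<alpha> where "c = 0" and w1: "\<And>x y t. w x y t = w 0 y 0 + \<alpha> y * x"
    and u1: "\<And>x y t. u x y t = u x y 0 + (1 - exp (2 * m * t)) / (2 * m) * \<alpha> y"
    by blast
  have yt': "exp (- 2 * - n * t) * vt x y t + wy x y t = 0" for x y t
    using yt by simp
  have "\<forall>x. \<exists>\<beta>. (\<forall>y t. w x y t = w x 0 0 + \<beta> * y) \<and>
      (\<forall>y t. v x y t = v x y 0 + (1 - exp (2 * - n * t)) / (2 * - n) * \<beta>)"
    (is "\<forall>x. \<exists>\<beta>. ?P x \<beta>")
  proof
    fix x
    show "\<exists>\<beta>. ?P x \<beta>"
      by (rule sol_planar_system[where f = "v x" and g = "w x"
        and ft = "vt x" and gs = "wy x" and \<mu> = "- n", OF _ vy vt wy wt yt'])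
        (use mn in simp, blast)
  qed
  from choice[OF this] obtain \<beta> where w2: "\<And>x y t. w x y t = w x 0 0 + \<beta> x * y"
    and v1: "\<And>x y t. v x y t = v x y 0 + (1 - exp (2 * - n * t)) / (2 * - n) * \<beta> x"
    by blast
  \<comment> \<open>Both \<open>2 * m * Q\<close> and \<open>2 * n * T\<close> are the coefficient
    of \<open>x * y\<close> in \<open>w\<close>; the divisors absorb those in \<open>u1\<close> and
    \<open>v1\<close>.\<close>
  define Q where "Q = (\<alpha> 1 - \<alpha> 0) / (2 * m)"
  define T where "T = (\<beta> 1 - \<beta> 0) / (2 * n)"
  define k l where "k = \<alpha> 0" and "l = \<beta> 0"
  \<comment> \<open>Both sides are the mixed second difference of \<open>w\<close> over the unit
    square at \<open>t = 0\<close>.\<close>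
  have "\<alpha> 1 - \<alpha> 0 = \<beta> 1 - \<beta> 0"
    using w1[of 1 0 0] w2[of 1 1 0] w2[of 0 1 0] w1[of 1 1 0] by simp
  \<comment> \<open>The crossing is deliberate: \<open>\<alpha> y\<close> grows with
    \<open>y\<close> at rate \<open>\<beta> 1 - \<beta> 0\<close>, and \<open>\<beta> x\<close> with
    \<open>x\<close> at rate \<open>\<alpha> 1 - \<alpha> 0\<close>.\<close>
  then have QT: "2 * m * Q = \<beta> 1 - \<beta> 0" "2 * n * T = \<alpha> 1 - \<alpha> 0"
    using mn by (simp_all add: Q_def T_def)
  have \<alpha>: "\<alpha> y = k + 2 * m * Q * y" for y
    unfolding QT k_def left_diff_distrib
    using w1[of 1 y 0] w2[of 1 y 0] w2[of 0 y 0] w1[of 1 0 0] by simp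
  have \<beta>: "\<beta> x = l + 2 * n * T * x" for x
    unfolding QT l_def left_diff_distrib
    using w2[of x 1 0] w1[of x 1 0] w1[of x 0 0] w2[of 0 1 0] by simp
  have affine: "((\<lambda>s. p + q * s) has_real_derivative q) (at s)" for p q s :: real
    by (auto intro!: derivative_eq_intros)
  have uy1: "uy x y t = uy x y 0 + (1 - exp (2 * m * t)) * Q" for x y t
  proof (rule DERIV_unique[OF uy])
    have "((\<lambda>y. u x y 0 + (1 - exp (2 * m * t)) / (2 * m) * (k + 2 * m * Q * y))
        has_real_derivative uy x y 0 + (1 - exp (2 * m * t)) / (2 * m) * (2 * m * Q)) (at y)"
      by (intro DERIV_add uy DERIV_cmult affine)
    moreover have "(\<lambda>y. u x y t) = (\<lambda>y. u x y 0 + (1 - exp (2 * m * t)) / (2 * m) * (k + 2 * m * Q * y))"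
      by (simp only: u1[of x _ t] \<alpha>)
    ultimately show "((\<lambda>y. u x y t) has_real_derivative uy x y 0 + (1 - exp (2 * m * t)) * Q) (at y)"
      using mn by simp
  qed
  have vx1: "vx x y t = vx x y 0 + (exp (- 2 * n * t) - 1) * T" for x y t
  proof (rule DERIV_unique[OF vx])
    have "((\<lambda>x. v x y 0 + (1 - exp (2 * - n * t)) / (2 * - n) * (l + 2 * n * T * x))
        has_real_derivative vx x y 0 + (1 - exp (2 * - n * t)) / (2 * - n) * (2 * n * T)) (at x)"
      by (intro DERIV_add vx DERIV_cmult affine)
    moreover have "(\<lambda>x. v x y t) = (\<lambda>x. v x y 0 + (1 - exp (2 * - n * t)) / (2 * - n) * (l + 2 * n * T * x))"
      by (simp only: v1[of _ y t] \<beta>)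
    moreover have "(1 - exp (2 * - n * t)) / (2 * - n) * (2 * n * T) = (exp (- 2 * n * t) - 1) * T"
      using mn by (simp add: field_simps)
    ultimately show "((\<lambda>x. v x y t) has_real_derivative vx x y 0 + (exp (- 2 * n * t) - 1) * T) (at x)"
      by (simp only:)
  qed
  \<comment> \<open>Equation \<open>xy\<close> after inserting \<open>uy1\<close> and
    \<open>vx1\<close>, sorted by exponentials so that \<open>exp_independent\<close> applies in
    \<open>t\<close>.\<close>
  have PQR: "exp (- 2 * m * t) * (uy x y 0 + Q) + (T - Q) + exp (2 * n * t) * (vx x y 0 - T) = 0" for x y t
  proof -
    have *: "E * (U + Q) + (T - Q) + G * (V - T)
        = (E * (U + (1 - F) * Q) + G * (V + (H - 1) * T)) + (E * F - 1) * Q + (1 - G * H) * T"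
      for E F G H U V :: real
      by (simp add: algebra_simps)
    have "exp (- 2 * m * t) * exp (2 * m * t) = 1" "exp (2 * n * t) * exp (- 2 * n * t) = 1"
      by (simp_all flip: exp_add)
    then have "(exp (- 2 * m * t) * exp (2 * m * t) - 1) * Q + (1 - exp (2 * n * t) * exp (- 2 * n * t)) * T = 0"
      by simp
    with xy[of t x y] *[of "exp (- 2 * m * t)" "uy x y 0" "exp (2 * n * t)" "vx x y 0"
        "exp (2 * m * t)" "exp (- 2 * n * t)"]
    show ?thesis
      unfolding uy1[of x y t] vx1[of x y t] by linarith
  qed
  have uy0: "uy x y 0 = - Q" and vx0: "vx x y 0 = T" for x y
    using exp_independent(1,3)[OF mn PQR] by (simp_all add: eq_neg_iff_add_eq_0)
  have u0: "u x y 0 = u x 0 0 - Q * y" for x y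
    using constant_derivative_affine[of "\<lambda>y. u x y 0" "- Q" y] uy[of x 0] by (simp add: uy0)
  have v0: "v x y 0 = v 0 y 0 + T * x" for x y
    using constant_derivative_affine[of "\<lambda>x. v x y 0" T x] vx[of y 0] by (simp add: vx0)
  \<comment> \<open>By \<open>u0\<close> the \<open>x\<close>-derivative of \<open>u x y 0\<close>
    does not depend on \<open>y\<close>; by \<open>ux\<close> it equals
    \<open>m * w x y 0 + a\<close>.\<close>
  have wy0: "w x y 0 = w x 0 0" for x y
  proof -
    have "((\<lambda>x. u x 0 0 - Q * y) has_real_derivative (m * w x 0 0 + a) - 0) (at x)"
      by (intro DERIV_diff ux DERIV_const)
    moreover have "(\<lambda>x. u x 0 0 - Q * y) = (\<lambda>x. u x y 0)"
      using u0[of _ y] by simp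
    ultimately have "m * w x y 0 + a = (m * w x 0 0 + a) - 0"
      using DERIV_unique[OF ux[of y 0 x]] by simp
    then show ?thesis using mn by simp
  qed
  have wx0: "w x y 0 = w 0 y 0" for x y
  proof -
    have "((\<lambda>y. v 0 y 0 + T * x) has_real_derivative (- n * w 0 y 0 + b) + 0) (at y)"
      by (intro DERIV_add vy DERIV_const)
    moreover have "(\<lambda>y. v 0 y 0 + T * x) = (\<lambda>y. v x y 0)"
      using v0[of x] by simp
    ultimately have "- n * w x y 0 + b = (- n * w 0 y 0 + b) + 0"
      using DERIV_unique[OF vy[of x 0 y]] by simp
    then show ?thesis using mn by simp
  qed
  have \<alpha>0: "\<alpha> y = 0" and \<beta>0: "\<beta> x = 0" for x y
    using w1[of 1 y 0] wx0[of 1 y] w2[of x 1 0] wy0[of x 1] by simp_all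
  have QT0: "Q = 0" "T = 0" by (simp_all add: Q_def T_def \<alpha>0 \<beta>0)
  define c1 where "c1 = w 0 0 0"
  have w: "w x y t = c1" for x y t
    using w1[of x y t] wy0[of 0 y] by (simp add: \<alpha>0 c1_def)
  have "((\<lambda>x. u x 0 0) has_real_derivative m * c1 + a) (at x)" for x
    using ux[of 0 0 x] by (simp only: w)
  note ux0 = constant_derivative_affine[OF this]
  have u: "u x y t = (m * c1 + a) * x + u 0 0 0" for x y t
    using u1[of x y t] u0[of x y] ux0[of x] by (simp add: \<alpha>0 QT0)
  have "((\<lambda>y. v 0 y 0) has_real_derivative - n * c1 + b) (at y)" for y
    using vy[of 0 0 y] by (simp only: w)
  note vy0 = constant_derivative_affine[OF this]
  have v: "v x y t = (b - n * c1) * y + v 0 0 0" for x y t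
    using v1[of x y t] v0[of x y] vy0[of y] by (simp add: \<beta>0 QT0)
  show ?thesis
    by (rule that[OF \<open>c = 0\<close> w u v])
qed

section \<open>Explicit form of the soliton fields\<close>

lemma pd_line_3:
  fixes f :: "real ^ 3 \<Rightarrow> real"
  assumes "smooth_fun f"
  shows "((\<lambda>x. f (vector [x, y, t])) has_real_derivative pd 1 f (vector [x, y, t])) (at x)"
    and "((\<lambda>y. f (vector [x, y, t])) has_real_derivative pd 2 f (vector [x, y, t])) (at y)"
    and "((\<lambda>t. f (vector [x, y, t])) has_real_derivative pd 3 f (vector [x, y, t])) (at t)"
proof -
  have line: "vector [0, y, t] + s *\<^sub>R axis 1 1 = (vector [s, y, t] :: real ^ 3)"
    "vector [x, 0, t] + s *\<^sub>R axis 2 1 = (vector [x, s, t] :: real ^ 3)"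
    "vector [x, y, 0] + s *\<^sub>R axis 3 1 = (vector [x, y, s] :: real ^ 3)" for s :: real
    by (simp_all add: vec_eq_iff forall_3 axis_def)
  note pd = pd_line[OF smooth_fun_differentiable[OF assms]]
  show "((\<lambda>x. f (vector [x, y, t])) has_real_derivative pd 1 f (vector [x, y, t])) (at x)"
    using pd[of "vector [0, y, t]" 1] by (simp only: line)
  show "((\<lambda>y. f (vector [x, y, t])) has_real_derivative pd 2 f (vector [x, y, t])) (at y)"
    using pd[of "vector [x, 0, t]" 2] by (simp only: line)
  show "((\<lambda>t. f (vector [x, y, t])) has_real_derivative pd 3 f (vector [x, y, t])) (at t)"
    using pd[of "vector [x, y, 0]" 3] by (simp only: line)
qed

lemma sol_soliton_eqs_solution:
  assumes mn: "m > 0" "n > 0" and \<xi>: "smooth_vf \<xi>" and eqs: "\<And>p. sol_soliton_eqs m n \<xi> c p"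
  obtains c1 c2 c3 where "c = - m\<^sup>2 - n\<^sup>2"
    "\<And>p. \<xi> p = vector [(m * c1 - m * n - n\<^sup>2) * p $ 1 + c2, - ((n * c1 + m * n + m\<^sup>2) * p $ 2 + c3), c1]"
proof -
  define F where "F i x y t = \<xi> (vector [x, y, t]) $ i" for i x y t
  define P where "P j i x y t = pd j (\<lambda>q. \<xi> q $ i) (vector [x, y, t])" for j i x y t
  define a b where "a = c + m\<^sup>2 - m * n" and "b = c + n\<^sup>2 - m * n"
  have d: "((\<lambda>x. F i x y t) has_real_derivative P 1 i x y t) (at x)"
    "((\<lambda>y. F i x y t) has_real_derivative P 2 i x y t) (at y)"
    "((\<lambda>t. F i x y t) has_real_derivative P 3 i x y t) (at t)" for i x y t
    unfolding F_def P_def by (rule pd_line_3[OF smooth_vfD[OF \<xi>]])+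
  have e: "P 1 1 x y t = m * F 3 x y t + a" "P 2 2 x y t = - n * F 3 x y t + b"
    "P 3 3 x y t = c + m\<^sup>2 + n\<^sup>2"
    "exp (- 2 * m * t) * P 2 1 x y t + exp (2 * n * t) * P 1 2 x y t = 0"
    "exp (- 2 * m * t) * P 3 1 x y t + P 1 3 x y t = 0"
    "exp (2 * n * t) * P 3 2 x y t + P 2 3 x y t = 0" for x y t
    using eqs[of "vector [x, y, t]"] unfolding sol_soliton_eqs_def vector_3
    by (simp_all add: F_def P_def a_def b_def)
  obtain c1 c2 c3 where c: "c + m\<^sup>2 + n\<^sup>2 = 0" "\<And>x y t. F 3 x y t = c1"
    "\<And>x y t. F 1 x y t = (m * c1 + a) * x + c2" "\<And>x y t. F 2 x y t = (b - n * c1) * y + c3"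
    by (rule sol_soliton_system[OF mn d(1)[of 1, unfolded e(1)] d(2)[of 1] d(3)[of 1]
        d(1)[of 2] d(2)[of 2, unfolded e(2)] d(3)[of 2] d(1)[of 3] d(2)[of 3]
        d(3)[of 3, unfolded e(3)] e(4-6)]) (rule that)
  have "vector [p $ 1, p $ 2, p $ 3] = p" for p :: "real ^ 3"
    by (simp add: vec_eq_iff forall_3 vector_3)
  then have "\<xi> p $ i = F i (p $ 1) (p $ 2) (p $ 3)" for p i
    by (simp add: F_def)
  moreover have ab: "a = - m * n - n\<^sup>2" "b = - m * n - m\<^sup>2"
    using c(1) by (simp_all add: a_def b_def)
  \<comment> \<open>The integration constant changes sign because the required form negates the
    whole second component.\<close>
  ultimately have "\<xi> p = vector [(m * c1 - m * n - n\<^sup>2) * p $ 1 + c2,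
      - ((n * c1 + m * n + m\<^sup>2) * p $ 2 + - c3), c1]" for p
    by (simp only: vec_eq_iff forall_3 vector_3 c ab) (simp add: algebra_simps)
  moreover have "c = - m\<^sup>2 - n\<^sup>2" using c(1) by simp
  ultimately show ?thesis by (rule that[rotated])
qed

text \<open>The first two components are affine in their own coordinate and the third is constant,
  so the off-diagonal equations are trivial and the diagonal ones are arithmetic.\<close>

lemma sol_soliton_eqs_family:
  assumes "\<And>p. \<xi> p = vector [(m * c1 - m * n - n\<^sup>2) * p $ 1 + c2, - ((n * c1 + m * n + m\<^sup>2) * p $ 2 + c3), c1]"
  shows "sol_soliton_eqs m n \<xi> (- m\<^sup>2 - n\<^sup>2) p"
proof -
  have d: "((\<lambda>q. k * q $ j + l) has_derivative (\<lambda>h. k * h $ j)) (at p)" for k l and j :: 3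
    by (auto intro!: derivative_eq_intros bounded_linear.has_derivative[OF bounded_linear_vec_nth])
  have "pd i (\<lambda>q. k * q $ j + l) p = (if i = j then k else 0)" for i j :: 3 and k l
    by (simp add: has_derivative_pd[OF d] axis_def)
  note affine = this
  have d_neg: "((\<lambda>q. - (k * q $ j + l)) has_derivative (\<lambda>h. - (k * h $ j))) (at p)" for k l and j :: 3
    by (intro has_derivative_minus d)
  have "pd i (\<lambda>q. - (k * q $ j + l)) p = (if i = j then - k else 0)" for i j :: 3 and k l
    by (subst has_derivative_pd[OF d_neg]) (simp add: axis_def)
  note affine = affine this
  show ?thesis
    unfolding sol_soliton_eqs_def assms vector_3 affine
    by (simp add: power2_eq_square algebra_simps)
qed

theorem theorem1:
  fixes m n :: real and \<xi> :: "3 vector_field"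
  assumes "m > 0" and "n > 0" and "smooth_vf \<xi>"
  shows "((\<exists>lam. ricci_soliton (sol_metric m n) \<xi> lam) \<longleftrightarrow>
      (\<exists>c1 c2 c3. \<forall>p.
         let x = p $ 1; y = p $ 2; t = p $ 3 in
         \<xi> p = (exp (- m * t) * ((m * c1 - m * n - n^2) * x + c2)) *\<^sub>R sol_e1 m n p
             - (exp (n * t) * ((n * c1 + m * n + m^2) * y + c3)) *\<^sub>R sol_e2 m n p
             + c1 *\<^sub>R sol_e3 m n p)) \<and>
    (\<forall>lam. ricci_soliton (sol_metric m n) \<xi> lam \<longrightarrow>
       expanding_ricci_soliton (sol_metric m n) \<xi> lam \<and> lam = - (m^2) - n^2)"
    (is "(_ \<longleftrightarrow> (\<exists>c1 c2 c3. \<forall>p. ?form c1 c2 c3 p)) \<and> _")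
proof -
  \<comment> \<open>The exponential prefactors cancel those in \<open>sol_e1\<close> and
    \<open>sol_e2\<close>, which leaves plain coordinate components.\<close>
  have frame: "(exp (- m * p $ 3) * \<alpha>) *\<^sub>R sol_e1 m n p - (exp (n * p $ 3) * \<beta>) *\<^sub>R sol_e2 m n p
      + \<gamma> *\<^sub>R sol_e3 m n p = vector [\<alpha>, - \<beta>, \<gamma>]" for p \<alpha> \<beta> \<gamma>
    by (simp add: vec_eq_iff forall_3 vector_3 sol_e1_def sol_e2_def sol_e3_def axis_def exp_minus)
  have form: "?form c1 c2 c3 p \<longleftrightarrow>
      \<xi> p = vector [(m * c1 - m * n - n\<^sup>2) * p $ 1 + c2, - ((n * c1 + m * n + m\<^sup>2) * p $ 2 + c3), c1]"
    for c1 c2 c3 p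
    unfolding Let_def frame ..
  have "lam = - m\<^sup>2 - n\<^sup>2 \<and> (\<exists>c1 c2 c3. \<forall>p. ?form c1 c2 c3 p)"
    if "ricci_soliton (sol_metric m n) \<xi> lam" for lam
    using sol_soliton_eqs_solution[OF assms] that
    unfolding sol_ricci_soliton_iff[OF assms(3)] form by metis
  \<comment> \<open>The value of \<lambda> forced above is also the witness for the
    converse.\<close>
  moreover have "ricci_soliton (sol_metric m n) \<xi> (- m\<^sup>2 - n\<^sup>2)" if "\<forall>p. ?form c1 c2 c3 p" for c1 c2 c3
    using that sol_soliton_eqs_family unfolding sol_ricci_soliton_iff[OF assms(3)] form by blast
  moreover have "- m\<^sup>2 - n\<^sup>2 < 0"
    using zero_less_power[OF assms(1), of 2] zero_less_power[OF assms(2), of 2] by linarith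
  ultimately show ?thesis
    unfolding expanding_ricci_soliton_def by blast
qed

end
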